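(* Assume $\psi\in S_1^2(\mathbb{D})$ is not a constant. If the multiplication operator $M_\psi$, $M_\psi f=\psi f$, is an $m$-isometry on $S_1^2(\mathbb{D})$ for some integer $m\ge1$, then $\psi$ is a finite Blaschke product. Consequently, $M_\psi$ is a strict $3$-isometry on $S_1^2(\mathbb{D})$.
   Context: $\mathbb{D}$ is the open unit disk and $H(\mathbb{D})$ the space of analytic functions on $\mathbb{D}$; for $f\in H(\mathbb{D})$ write $f(z)=\sum_{n\ge 0}f_nz^n$. The derivative Hardy space is the Hilbert space $S_1^2(\mathbb{D})=\{f\in H(\mathbb{D}):\|f\|_{S_1^2}^2=\sum_{n\ge0}\frac{(n+1)(n+2)}{2}|f_n|^2<\infty\}$. A bounded operator $T$ on a Hilbert space $H$ is an $m$-isometry ($m\ge1$ an integer) if $\sum_{k=0}^m(-1)^{m-k}\binom{m}{k}\|T^kh\|^2=0$ for all $h\in H$; it is a strict $m$-isometry if it is an $m$-isometry but not an $(m-1)$-isometry. (Every $\psi\in S_1^2(\mathbb{D})$ gives a bounded operator $M_\psi$ on $S_1^2(\mathbb{D})$.) *)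

theory Defs
  imports "HOL-Complex_Analysis.Complex_Analysis"
begin

text \<open>
  Analytic functions on the unit disc are represented by total functions that are holomorphic
  on \<^term>\<open>ball 0 1 :: complex set\<close>; values outside the disc carry no meaning, and two such
  functions denote the same element iff they agree on the disc.
\<close>

definition taylor_coeff :: "(complex \<Rightarrow> complex) \<Rightarrow> nat \<Rightarrow> complex" where
  "taylor_coeff f n = (deriv ^^ n) f 0 / fact n"

definition S12 :: "(complex \<Rightarrow> complex) set" where
  "S12 = {f. f holomorphic_on ball 0 1 \<and>
             summable (\<lambda>n. (real n + 1) * (real n + 2) / 2 * (cmod (taylor_coeff f n))\<^sup>2)}"

definition S12_norm :: "(complex \<Rightarrow> complex) \<Rightarrow> real" where
  "S12_norm f = sqrt (\<Sum>n. (real n + 1) * (real n + 2) / 2 * (cmod (taylor_coeff f n))\<^sup>2)"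

text \<open>
  Linearity is required only on the disc. Together with boundedness it implies that the operator
  respects equality on the disc, so it is well defined on the elements of the space.
\<close>

definition bounded_operator_S12 :: "((complex \<Rightarrow> complex) \<Rightarrow> (complex \<Rightarrow> complex)) \<Rightarrow> bool" where
  "bounded_operator_S12 T \<longleftrightarrow>
     (\<forall>f\<in>S12. T f \<in> S12) \<and>
     (\<forall>f\<in>S12. \<forall>g\<in>S12. \<forall>a b. \<forall>z\<in>ball 0 1.
        T (\<lambda>w. a * f w + b * g w) z = a * T f z + b * T g z) \<and>
     (\<exists>C. \<forall>f\<in>S12. S12_norm (T f) \<le> C * S12_norm f)"

text \<open>
  For \<open>m = 0\<close> the identity reads \<open>S12_norm h = 0\<close> for all \<open>h\<close>, which no operator on a nonzero
  space satisfies; hence every 1-isometry is strict.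
\<close>

definition m_isometry :: "nat \<Rightarrow> ((complex \<Rightarrow> complex) \<Rightarrow> (complex \<Rightarrow> complex)) \<Rightarrow> bool" where
  "m_isometry m T \<longleftrightarrow> bounded_operator_S12 T \<and>
     (\<forall>h\<in>S12. (\<Sum>k=0..m. (-1) ^ (m - k) * real (m choose k) * (S12_norm ((T ^^ k) h))\<^sup>2) = 0)"

definition strict_m_isometry :: "nat \<Rightarrow> ((complex \<Rightarrow> complex) \<Rightarrow> (complex \<Rightarrow> complex)) \<Rightarrow> bool" where
  "strict_m_isometry m T \<longleftrightarrow> m \<ge> 1 \<and> m_isometry m T \<and> \<not> m_isometry (m - 1) T"

definition mult_operator :: "(complex \<Rightarrow> complex) \<Rightarrow> (complex \<Rightarrow> complex) \<Rightarrow> (complex \<Rightarrow> complex)" where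
  "mult_operator \<psi> f = (\<lambda>z. \<psi> z * f z)"

text \<open>
  The zeros are listed with multiplicity. The usual normalising factors \<open>\<bar>a\<bar> / a\<close> are absorbed
  into the unimodular constant.
\<close>

definition finite_blaschke_product :: "(complex \<Rightarrow> complex) \<Rightarrow> bool" where
  "finite_blaschke_product B \<longleftrightarrow>
     (\<exists>c as. cmod c = 1 \<and> set as \<subseteq> ball 0 1 \<and>
        (\<forall>z\<in>ball 0 1. B z = c * (\<Prod>a\<leftarrow>as. (z - a) / (1 - cnj a * z))))"

end

theory Submission
  imports Defs
begin

text \<open>
  Let \<open>p k = \<parallel>\<psi>\<^sup>k h\<parallel>\<^sup>2\<close> in the derivative Hardy space. The operator \<open>M\<^sub>\<psi>\<close> is an \<open>m\<close>-isometry iff, for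
  every \<open>h\<close>, the \<open>m\<close>-th forward difference of \<open>p\<close> vanishes identically
  (\<open>m_isometry_iff_fdiff\<close>); then \<open>p\<close> is a polynomial in \<open>k\<close> of degree below \<open>m\<close>.

  The weight \<open>(n + 1) (n + 2) / 2\<close> is quadratic in \<open>n\<close> with leading coefficient \<open>1/2\<close>, so
  \<open>\<parallel>z\<^sup>N f\<parallel>\<^sup>2\<close> is quadratic in \<open>N\<close> and its second difference is the squared Hardy norm
  \<open>\<Sum> \<bar>f\<^sub>n\<bar>\<^sup>2\<close> (\<open>hardy_norm_sq_eq_second_difference\<close>). Multiplication by \<open>\<psi>\<close> commutes with
  multiplication by \<open>z\<close>, so the \<open>m\<close>-th difference of the squared Hardy norms of \<open>\<psi>\<^sup>k\<close> vanishes too. The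
  Taylor series of \<open>\<psi>\<close> converges absolutely on the closed disc, and Parseval's identity turns the
  vanishing difference into \<open>\<integral> (\<bar>\<psi>\<bar>\<^sup>2 - 1)\<^sup>m = 0\<close> over the unit circle. An \<open>m\<close>-isometry is an
  \<open>M\<close>-isometry for every \<open>M \<ge> m\<close>, so the exponent may be taken even, the integrand is
  nonnegative, and \<open>\<bar>\<psi>\<bar> = 1\<close> on the circle (\<open>boundary_ext_unimodular\<close>).

  A holomorphic function on the disc whose modulus tends to \<open>1\<close> at the circle has finitely many
  zeros. Dividing them out by Blaschke factors leaves a zero-free function with the same boundary
  behaviour, which is a unimodular constant by the maximum principle
  (\<open>finite_blaschke_product_of_boundary\<close>).

  For the order \<open>3\<close>: since \<open>\<bar>\<psi>\<bar> \<le> 1\<close>, the derivative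
  \<open>(\<psi>\<^sup>k h)' = k \<psi>\<^sup>k\<^sup>-\<^sup>1 \<psi>' h + \<psi>\<^sup>k h'\<close> has Hardy norm \<open>O(k)\<close>, so \<open>p k = O(k\<^sup>2)\<close>. A polynomial
  with this growth has degree at most \<open>2\<close>, whatever \<open>m\<close> was, and its third difference is zero. For
  \<open>h = 1\<close> the growth is really quadratic: multiplication by a function of boundary modulus \<open>1\<close>
  does not decrease the Hardy norm, so \<open>p k\<close> is at least half the squared Hardy norm of
  \<open>k \<psi>'\<close>, and \<open>\<psi>' \<noteq> 0\<close>. An affine \<open>p\<close> is therefore excluded, and \<open>M\<^sub>\<psi>\<close> is not a
  \<open>2\<close>-isometry.
\<close>

section \<open>Forward differences of sequences\<close>

definition fdiff :: "(nat \<Rightarrow> real) \<Rightarrow> nat \<Rightarrow> real" where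
  "fdiff p = (\<lambda>j. p (Suc j) - p j)"

lemma fdiff_funpow_Suc: "(fdiff ^^ Suc m) p j = (fdiff ^^ m) p (Suc j) - (fdiff ^^ m) p j"
  by (simp add: fdiff_def)

lemma fdiff_funpow_eq_sum:
  "(fdiff ^^ m) p j = (\<Sum>k=0..m. (-1) ^ (m - k) * real (m choose k) * p (j + k))"
proof (induction m arbitrary: j)
  case 0
  show ?case by simp
next
  case (Suc m)
  let ?s = "\<lambda>k. (-1) ^ (m - k) * real (m choose k)"
  have low: "(\<Sum>k\<le>m. ?s k * p (j + k)) =
        ?s 0 * p j + (\<Sum>k\<le>m. - ((-1) ^ (m - k)) * real (m choose Suc k) * p (Suc (j + k)))"
  proof -
    have "(\<Sum>k\<le>m. ?s k * p (j + k)) = (\<Sum>k\<le>Suc m. ?s k * p (j + k))"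
      by simp
    also have "\<dots> = ?s 0 * p j + (\<Sum>k\<le>m. ?s (Suc k) * p (j + Suc k))"
      by (subst sum.atMost_Suc_shift) simp
    also have "(\<Sum>k\<le>m. ?s (Suc k) * p (j + Suc k)) =
        (\<Sum>k\<le>m. - ((-1) ^ (m - k)) * real (m choose Suc k) * p (Suc (j + k)))"
    proof (rule sum.cong)
      fix k assume "k \<in> {..m}"
      show "?s (Suc k) * p (j + Suc k) =
            - ((-1) ^ (m - k)) * real (m choose Suc k) * p (Suc (j + k))"
      proof (cases "k = m")
        case False
        then have "m - k = Suc (m - Suc k)"
          using \<open>k \<in> {..m}\<close> by simp
        then show ?thesis by simp
      qed simp
    qed simp
    finally show ?thesis .
  qed
  have "(fdiff ^^ Suc m) p j = (fdiff ^^ m) p (Suc j) - (fdiff ^^ m) p j"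
    by (rule fdiff_funpow_Suc)
  also have "\<dots> = (\<Sum>k\<le>m. ?s k * p (Suc (j + k))) - (\<Sum>k\<le>m. ?s k * p (j + k))"
    unfolding Suc.IH by (simp add: atLeast0AtMost)
  also have "\<dots> = - ((-1) ^ m * p j) +
      (\<Sum>k\<le>m. (-1) ^ (m - k) * real (Suc m choose Suc k) * p (Suc (j + k)))"
    unfolding low by (simp add: algebra_simps sum.distrib sum_subtractf sum_negf)
  also have "\<dots> = (\<Sum>k\<le>Suc m. (-1) ^ (Suc m - k) * real (Suc m choose k) * p (j + k))"
    by (subst sum.atMost_Suc_shift) simp
  finally show ?case by (simp add: atLeast0AtMost)
qed

text \<open>
  For the squared norms of the iterates of an operator this says that an \<open>m\<close>-isometry is an
  \<open>n\<close>-isometry for all \<open>n \<ge> m\<close>.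
\<close>

lemma fdiff_funpow_eq_0_mono:
  assumes "\<And>j. (fdiff ^^ m) p j = 0" "m \<le> n"
  shows "(fdiff ^^ n) p j = 0"
  using assms(2)
proof (induction n arbitrary: j rule: dec_induct)
  case base
  show ?case using assms(1) by simp
next
  case (step n)
  then show ?case by (simp only: fdiff_funpow_Suc)
qed

text \<open>
  Newton's forward difference formula, which exhibits such a \<open>p\<close> as a polynomial of degree below
  \<open>m\<close>. Induction on \<open>m\<close>: expand the difference of \<open>p\<close> and sum it with the hockey-stick
  identity.
\<close>

lemma newton_expansion:
  assumes "\<And>j. (fdiff ^^ m) p j = 0"
  shows "p k = (\<Sum>i<m. (fdiff ^^ i) p 0 * real (k choose i))"
  using assms
proof (induction m arbitrary: p k)
  case 0
  then show ?case by simp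
next
  case (Suc m)
  have shift: "(fdiff ^^ i) (fdiff p) = (fdiff ^^ Suc i) p" for i
    by (simp add: funpow_swap1)
  have IH: "fdiff p l = (\<Sum>i<m. (fdiff ^^ Suc i) p 0 * real (l choose i))" for l
    using Suc.IH[of "fdiff p" l] Suc.prems shift by simp
  have hockey: "(\<Sum>l<k. real (l choose i)) = real (k choose Suc i)" for i
  proof (cases k)
    case (Suc n)
    then show ?thesis
      using arg_cong[OF sum_choose_upper[of i n], of real]
      by (simp add: lessThan_Suc_atMost)
  qed simp
  have "p k = p 0 + (\<Sum>l<k. fdiff p l)"
    by (simp add: fdiff_def sum_lessThan_telescope)
  also have "(\<Sum>l<k. fdiff p l) = (\<Sum>i<m. (fdiff ^^ Suc i) p 0 * real (k choose Suc i))"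
    unfolding IH by (subst sum.swap) (simp add: hockey flip: sum_distrib_left)
  also have "p 0 + \<dots> = (\<Sum>i<Suc m. (fdiff ^^ i) p 0 * real (k choose i))"
    by (subst sum.lessThan_Suc_shift) simp
  finally show ?case .
qed

lemma choose_over_power_tendsto:
  assumes "i \<le> n"
  shows "(\<lambda>k. real (k choose i) / real k ^ n) \<longlonglongrightarrow> (if i = n then 1 / fact n else 0)"
proof -
  have *: "(\<lambda>k. real (k choose i) / real k ^ i) \<longlonglongrightarrow> 1 / fact i"
  proof -
    have "(\<lambda>k. (\<Prod>l<i. 1 - real l / real k) / fact i) \<longlonglongrightarrow> (\<Prod>l<i. 1 - 0) / fact i"
      by (intro tendsto_intros tendsto_divide_0[OF tendsto_const] 
          filterlim_at_top_imp_at_infinity filterlim_real_sequentially) auto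
    moreover have "\<forall>\<^sub>F k in sequentially. 
        (\<Prod>l<i. 1 - real l / real k) / fact i = real (k choose i) / real k ^ i"
      using eventually_gt_at_top[of "max 0 i"]
    proof eventually_elim
      case (elim k)
      have "real (k choose i) = (\<Prod>l<i. real k - real l) / fact i"
        by (simp add: binomial_gbinomial gbinomial_prod_rev atLeast0LessThan)
      also have "(\<Prod>l<i. real k - real l) = (\<Prod>l<i. real k * (1 - real l / real k))"
        using elim by (intro prod.cong) (auto simp: field_simps)
      also have "\<dots> = real k ^ i * (\<Prod>l<i. (1 - real l / real k))"
        by (simp add: prod.distrib)
      finally show ?case using elim by simp
    qed
    ultimately show ?thesis by (simp add: filterlim_cong)
  qed
  show ?thesis
  proof (cases "i = n")
    case False
    with assms have "n - i > 0" by simp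
    then have "(\<lambda>k. inverse (real k) ^ (n - i)) \<longlonglongrightarrow> 0 ^ (n - i)"
      by (intro tendsto_power lim_inverse_n)
    then have "(\<lambda>k. real (k choose i) / real k ^ i * inverse (real k) ^ (n - i)) \<longlonglongrightarrow> 1 / fact i * 0"
      using \<open>n - i > 0\<close> by (intro tendsto_mult *) (simp add: zero_power)
    moreover have "real (k choose i) / real k ^ i * inverse (real k) ^ (n - i) 
        = real (k choose i) / real k ^ n" for k
      using assms by (simp add: field_simps flip: power_add)
    ultimately show ?thesis using False by simp
  qed (use * in simp)
qed

text \<open>
  Induction on \<open>m\<close>, lowering the degree as long as it exceeds \<open>d\<close>: when the \<open>m\<close>-th difference
  is a constant \<open>c\<close>, Newton's formula gives \<open>p k / k\<^sup>m \<longlonglongrightarrow> c / m!\<close>, and for \<open>m > d\<close> the growth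
  bound forces \<open>c = 0\<close>.
\<close>

lemma fdiff_eq_0_of_growth:
  assumes "\<And>j. (fdiff ^^ m) p j = 0" and growth: "\<And>k. \<bar>p k\<bar> \<le> C * (real k + 1) ^ d"
  shows "(fdiff ^^ Suc d) p j = 0"
  using assms(1)
proof (induction m arbitrary: j)
  case 0
  show ?case
    by (rule fdiff_funpow_eq_0_mono[of 0]) (use 0 in auto)
next
  case (Suc m)
  show ?case
  proof (cases "m \<le> d")
    case True
    show ?thesis
      by (rule fdiff_funpow_eq_0_mono[of "Suc m"]) (use Suc.prems True in auto)
  next
    case False
    define c where "c = (fdiff ^^ m) p 0"
    have step: "(fdiff ^^ m) p (Suc j) = (fdiff ^^ m) p j" for j
      using Suc.prems[of j] by (simp only: fdiff_funpow_Suc)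
    have const: "(fdiff ^^ m) p j = c" for j
    proof (induction j)
      case (Suc j)
      then show ?case using step by simp
    qed (simp add: c_def)
    have "(\<lambda>k. (\<Sum>i<Suc m. (fdiff ^^ i) p 0 * (real (k choose i) / real k ^ m)))
        \<longlonglongrightarrow> (\<Sum>i<Suc m. (fdiff ^^ i) p 0 * (if i = m then 1 / fact m else 0))"
      by (intro tendsto_sum tendsto_mult tendsto_const choose_over_power_tendsto) auto
    also have "(\<lambda>k. (\<Sum>i<Suc m. (fdiff ^^ i) p 0 * (real (k choose i) / real k ^ m)))
        = (\<lambda>k. p k / real k ^ m)"
      by (subst newton_expansion[of "Suc m" p, OF Suc.prems])
         (simp add: sum_divide_distrib add_divide_distrib)
    also have "(\<Sum>i<Suc m. (fdiff ^^ i) p 0 * (if i = m then 1 / fact m else 0)) = c / fact m"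
      by (simp add: c_def)
    finally have lim: "(\<lambda>k. p k / real k ^ m) \<longlonglongrightarrow> c / fact m" .
    have "(\<lambda>k. C * (1 + 1 / real k) ^ d * (1 / real k) ^ (m - d)) \<longlonglongrightarrow> C * (1 + 0) ^ d * 0 ^ (m - d)"
      by (intro tendsto_intros lim_1_over_n)
    then have up: "(\<lambda>k. C * (1 + 1 / real k) ^ d * (1 / real k) ^ (m - d)) \<longlonglongrightarrow> 0"
      using False by (simp add: zero_power)
    have "(\<lambda>k. p k / real k ^ m) \<longlonglongrightarrow> 0"
    proof (rule Lim_null_comparison[OF _ up])
      show "\<forall>\<^sub>F k in sequentially. norm (p k / real k ^ m) 
          \<le> C * (1 + 1 / real k) ^ d * (1 / real k) ^ (m - d)"
        using eventually_gt_at_top[of 0]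
      proof eventually_elim
        case (elim k)
        have "m = d + (m - d)" using False by simp
        then have "real k ^ m = real k ^ d * real k ^ (m - d)"
          by (metis power_add)
        moreover have "1 + 1 / real k = (real k + 1) / real k"
          using elim by (simp add: field_simps)
        ultimately have "C * (1 + 1 / real k) ^ d * (1 / real k) ^ (m - d) 
            = C * (real k + 1) ^ d / real k ^ m"
          by (simp add: power_divide)
        then show ?case
          using growth[of k] by (simp add: abs_divide divide_right_mono)
      qed
    qed
    from LIMSEQ_unique[OF lim this] have "c = 0"
      by simp
    then show ?thesis using Suc.IH const by simp
  qed
qed

section \<open>Parseval's identity on circles\<close>

lemma has_integral_cis_multiple:
  "((\<lambda>t. cis (of_int k * t)) has_integral (if k = 0 then 2 * pi else 0)) {0..2 * pi}"
proof (cases "k = 0")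
  case True
  then show ?thesis
    using has_integral_const_real[of "1::complex" 0 "2 * pi"] by (simp add: scaleR_conv_of_real)
next
  case False
  have ii: "\<i> * (x * (\<i> * y)) = - (x * y)" for x y :: complex
    by (simp add: complex_eq_iff)
  let ?F = "\<lambda>t. cis (of_int k * t) / (\<i> * of_int k)"
  have "((\<lambda>t. cis (of_int k * t)) has_integral ?F (2 * pi) - ?F 0) {0..2 * pi}"
  proof (rule fundamental_theorem_of_calculus)
    fix t :: real
    show "(?F has_vector_derivative cis (of_int k * t)) (at t within {0..2 * pi})"
      unfolding has_vector_derivative_def using False
      by (auto intro!: derivative_eq_intros simp: scaleR_conv_of_real ii)
  qed simp
  moreover have "cis (of_int k * (2 * pi)) = 1"
    using cis_multiple_2pi[of "of_int k"] by (simp add: mult.commute mult.left_commute)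
  ultimately show ?thesis using False by simp
qed

text \<open>
  Orthogonality of the characters on the circle: only the diagonal terms of the double sum survive.
\<close>

lemma has_integral_circle_trig_poly:
  fixes a :: "nat \<Rightarrow> complex"
  shows "((\<lambda>t. (cmod (\<Sum>n<N. a n * cis (real n * t)))\<^sup>2) has_integral
          2 * pi * (\<Sum>n<N. (cmod (a n))\<^sup>2)) {0..2 * pi}"
proof -
  have "((\<lambda>t. \<Sum>j<N. \<Sum>k<N. a j * cnj (a k) * cis (of_int (int j - int k) * t)) has_integral
     (\<Sum>j<N. \<Sum>k<N. a j * cnj (a k) * (if int j - int k = 0 then 2 * pi else 0))) {0..2 * pi}"
    by (intro has_integral_sum has_integral_mult_right has_integral_cis_multiple) auto
  also have "(\<Sum>j<N. \<Sum>k<N. a j * cnj (a k) * (if int j - int k = 0 then 2 * pi else 0))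
      = of_real (2 * pi * (\<Sum>n<N. (cmod (a n))\<^sup>2))"
    by (simp add: if_distrib[of "\<lambda>x. _ * complex_of_real x"] sum_distrib_left mult_ac
        complex_norm_square del: of_real_power cong: if_cong)
  also have "(\<lambda>t. \<Sum>j<N. \<Sum>k<N. a j * cnj (a k) * cis (of_int (int j - int k) * t))
     = (\<lambda>t. of_real ((cmod (\<Sum>n<N. a n * cis (real n * t)))\<^sup>2))"
    unfolding complex_norm_square
    by (intro ext)
       (simp add: sum_product cis_cnj cis_mult algebra_simps)
  finally have "((Re \<circ> (\<lambda>t. of_real ((cmod (\<Sum>n<N. a n * cis (real n * t)))\<^sup>2))) has_integral
      Re (of_real (2 * pi * (\<Sum>n<N. (cmod (a n))\<^sup>2)))) {0..2 * pi}"
    by (rule has_integral_linear) (rule bounded_linear_Re)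
  then show ?thesis
    by (simp add: o_def)
qed

text \<open>
  The partial sums are bounded by \<open>\<Sum> \<bar>a\<^sub>n\<bar>\<close>, so dominated convergence passes from trigonometric
  polynomials to the limit. Absolute summability makes this applicable both to circles of radius
  less than \<open>1\<close> and, for functions in \<open>S12\<close>, to the unit circle itself.
\<close>

lemma parseval:
  fixes a :: "nat \<Rightarrow> complex"
  assumes "summable (\<lambda>n. cmod (a n))"
  shows "((\<lambda>t. (cmod (\<Sum>n. a n * cis (real n * t)))\<^sup>2) has_integral
          2 * pi * (\<Sum>n. (cmod (a n))\<^sup>2)) {0..2 * pi}"
proof -
  define S where "S = (\<lambda>N t. \<Sum>n<N. a n * cis (real n * t))"
  define A where "A = (\<Sum>n. cmod (a n))"
  have S_le: "cmod (S N t) \<le> A" for N t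
  proof -
    have "cmod (S N t) \<le> (\<Sum>n<N. cmod (a n))"
      unfolding S_def by (rule order_trans[OF norm_sum]) (simp add: norm_mult)
    also have "\<dots> \<le> A"
      unfolding A_def by (rule sum_le_suminf[OF assms]) auto
    finally show ?thesis .
  qed
  have S_lim: "(\<lambda>N. S N t) \<longlonglongrightarrow> (\<Sum>n. a n * cis (real n * t))" for t
    unfolding S_def
    by (rule summable_LIMSEQ, rule summable_norm_cancel) (simp add: norm_mult assms)
  have int_S: "((\<lambda>t. (cmod (S N t))\<^sup>2) has_integral 2 * pi * (\<Sum>n<N. (cmod (a n))\<^sup>2)) {0..2 * pi}"
    for N unfolding S_def by (rule has_integral_circle_trig_poly)
  have dom: "(\<lambda>t. (cmod (\<Sum>n. a n * cis (real n * t)))\<^sup>2) integrable_on {0..2 * pi}"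
       "(\<lambda>N. integral {0..2 * pi} (\<lambda>t. (cmod (S N t))\<^sup>2)) \<longlonglongrightarrow>
        integral {0..2 * pi} (\<lambda>t. (cmod (\<Sum>n. a n * cis (real n * t)))\<^sup>2)"
  proof -
    have 1: "(\<lambda>t. (cmod (S N t))\<^sup>2) integrable_on {0..2 * pi}" for N
      using int_S by blast
    have 2: "(\<lambda>t. A\<^sup>2) integrable_on {0..2 * pi}"
      by (rule integrable_const_ivl)
    have 3: "norm ((cmod (S N t))\<^sup>2) \<le> A\<^sup>2" for N t
      using power_mono[OF S_le[of N t], of 2] by simp
    have 4: "(\<lambda>N. (cmod (S N t))\<^sup>2) \<longlonglongrightarrow> (cmod (\<Sum>n. a n * cis (real n * t)))\<^sup>2" for t
      by (intro tendsto_intros S_lim)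
    show "(\<lambda>t. (cmod (\<Sum>n. a n * cis (real n * t)))\<^sup>2) integrable_on {0..2 * pi}"
       "(\<lambda>N. integral {0..2 * pi} (\<lambda>t. (cmod (S N t))\<^sup>2)) \<longlonglongrightarrow>
        integral {0..2 * pi} (\<lambda>t. (cmod (\<Sum>n. a n * cis (real n * t)))\<^sup>2)"
      using dominated_convergence[OF 1 2 3 4] by blast+
  qed
  have "summable (\<lambda>n. (cmod (a n))\<^sup>2)"
  proof (rule summable_comparison_test')
    show "summable (\<lambda>n. A * cmod (a n))"
      by (intro summable_mult assms)
    fix n
    have "cmod (a n) \<le> A"
      using sum_le_suminf[OF assms, of "{n}"] by (simp add: A_def)
    then show "norm ((cmod (a n))\<^sup>2) \<le> A * cmod (a n)"
      by (simp add: power2_eq_square mult_right_mono)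
  qed
  then have "(\<lambda>N. 2 * pi * (\<Sum>n<N. (cmod (a n))\<^sup>2)) \<longlonglongrightarrow> 2 * pi * (\<Sum>n. (cmod (a n))\<^sup>2)"
    by (intro tendsto_intros summable_LIMSEQ)
  from LIMSEQ_unique[OF dom(2)[unfolded integral_unique[OF int_S]] this]
  have "integral {0..2 * pi} (\<lambda>t. (cmod (\<Sum>n. a n * cis (real n * t)))\<^sup>2)
      = 2 * pi * (\<Sum>n. (cmod (a n))\<^sup>2)" .
  with dom(1) show ?thesis
    using integrable_integral by fastforce
qed

lemma taylor_coeff_sums:
  assumes "f holomorphic_on ball 0 1" "cmod z < 1"
  shows "(\<lambda>n. taylor_coeff f n * z ^ n) sums f z"
  using holomorphic_power_series[of f 0 1 z] assms by (simp add: taylor_coeff_def)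

lemma taylor_coeff_eq_fps_nth:
  assumes "f has_fps_expansion F"
  shows "taylor_coeff f n = fps_nth F n"
  using fps_nth_fps_expansion[OF assms] by (simp add: taylor_coeff_def)

lemma has_fps_expansion_taylor_coeff:
  assumes "f holomorphic_on ball 0 1"
  shows "f has_fps_expansion Abs_fps (taylor_coeff f)"
proof -
  have "f has_fps_expansion fps_expansion f 0"
    by (rule has_fps_expansion_fps_expansion[of "ball 0 1"]) (use assms in auto)
  moreover have "fps_expansion f 0 = Abs_fps (taylor_coeff f)"
    by (simp add: fps_expansion_def taylor_coeff_def fps_eq_iff)
  ultimately show ?thesis by simp
qed

lemma taylor_coeff_shift:
  assumes "f holomorphic_on ball 0 1"
  shows "taylor_coeff (\<lambda>z. z ^ N * f z) n = (if n < N then 0 else taylor_coeff f (n - N))"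
proof -
  have "(\<lambda>z. z ^ N * f z) has_fps_expansion fps_X ^ N * Abs_fps (taylor_coeff f)"
    by (intro fps_expansion_intros has_fps_expansion_taylor_coeff assms)
  from taylor_coeff_eq_fps_nth[OF this, of n] show ?thesis
    by (simp add: fps_X_power_mult_nth)
qed

lemma taylor_coeff_deriv:
  "taylor_coeff (deriv f) n = of_nat (Suc n) * taylor_coeff f (Suc n)"
  by (simp add: taylor_coeff_def funpow_swap1 field_simps del: of_nat_Suc)

lemma summable_cmod_taylor_coeff:
  assumes "f holomorphic_on ball 0 1" "0 \<le> r" "r < 1"
  shows "summable (\<lambda>n. cmod (taylor_coeff f n) * r ^ n)"
proof -
  define s where "s = (1 + r) / 2"
  have s: "r < s" "s < 1" "0 \<le> s"
    using assms by (auto simp: s_def)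
  have "summable (\<lambda>n. taylor_coeff f n * of_real s ^ n)"
    using taylor_coeff_sums[OF assms(1), of "of_real s"] s by (simp add: sums_iff)
  from powser_insidea[OF this, of "of_real r"] show ?thesis
    using assms s by (simp add: norm_mult norm_power)
qed

lemma circle_mean_eq:
  assumes "f holomorphic_on ball 0 1" "0 \<le> r" "r < 1"
  shows "((\<lambda>t. (cmod (f (of_real r * cis t)))\<^sup>2) has_integral
          2 * pi * (\<Sum>n. (cmod (taylor_coeff f n) * r ^ n)\<^sup>2)) {0..2 * pi}"
proof -
  let ?a = "\<lambda>n. taylor_coeff f n * of_real r ^ n"
  have "summable (\<lambda>n. cmod (?a n))"
    using summable_cmod_taylor_coeff[OF assms] assms by (simp add: norm_mult norm_power)
  from parseval[OF this]
  have "((\<lambda>t. (cmod (\<Sum>n. ?a n * cis (real n * t)))\<^sup>2) has_integral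
          2 * pi * (\<Sum>n. (cmod (?a n))\<^sup>2)) {0..2 * pi}" .
  moreover have "(\<Sum>n. ?a n * cis (real n * t)) = f (of_real r * cis t)" for t
  proof -
    have "(\<lambda>n. taylor_coeff f n * (of_real r * cis t) ^ n) sums f (of_real r * cis t)"
      using assms by (intro taylor_coeff_sums) (auto simp: norm_mult)
    then show ?thesis
      by (simp add: sums_iff power_mult_distrib Complex.DeMoivre mult.assoc)
  qed
  ultimately show ?thesis
    using assms by (simp add: norm_mult norm_power)
qed

section \<open>The derivative Hardy space and its shift\<close>

definition hardy_norm_sq :: "(complex \<Rightarrow> complex) \<Rightarrow> real" where
  "hardy_norm_sq f = (\<Sum>n. (cmod (taylor_coeff f n))\<^sup>2)"

lemma S12_holomorphic: "f \<in> S12 \<Longrightarrow> f holomorphic_on ball 0 1"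
  by (simp add: S12_def)

lemma S12_summable_power:
  assumes "f \<in> S12" "d \<le> 2"
  shows "summable (\<lambda>n. real n ^ d * (cmod (taylor_coeff f n))\<^sup>2)"
proof (rule summable_comparison_test')
  show "summable (\<lambda>n. 2 * ((real n + 1) * (real n + 2) / 2 * (cmod (taylor_coeff f n))\<^sup>2))"
    using assms by (intro summable_mult) (simp add: S12_def)
  fix n
  have "real n ^ d \<le> (real n + 1) ^ d"
    by (intro power_mono) auto
  also have "\<dots> \<le> (real n + 1) ^ 2"
    using assms by (intro power_increasing) auto
  also have "\<dots> \<le> (real n + 1) * (real n + 2)"
    by (simp add: power2_eq_square)
  finally show "norm (real n ^ d * (cmod (taylor_coeff f n))\<^sup>2)
      \<le> 2 * ((real n + 1) * (real n + 2) / 2 * (cmod (taylor_coeff f n))\<^sup>2)"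
    by (simp add: mult_right_mono)
qed

lemma S12_norm_power2:
  assumes "f \<in> S12"
  shows "(S12_norm f)\<^sup>2 = (\<Sum>n. (real n + 1) * (real n + 2) / 2 * (cmod (taylor_coeff f n))\<^sup>2)"
  using assms unfolding S12_norm_def
  by (intro real_sqrt_pow2 suminf_nonneg) (auto simp: S12_def)

text \<open>
  By the inequality of arithmetic and geometric means,
  \<open>\<bar>f\<^sub>n\<bar> = (n + 1) \<bar>f\<^sub>n\<bar> \<cdot> 1 / (n + 1)\<close> is dominated by a term of the norm plus \<open>1 / (n + 1)\<^sup>2\<close>. Hence
  functions in \<open>S12\<close> are bounded and extend continuously to the closed disc.
\<close>

lemma S12_summable_taylor_coeff:
  assumes "f \<in> S12"
  shows "summable (\<lambda>n. cmod (taylor_coeff f n))"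
proof (rule summable_comparison_test')
  show "summable (\<lambda>n. (real n + 1) * (real n + 2) / 2 * (cmod (taylor_coeff f n))\<^sup>2
      + inverse (real (Suc n) ^ 2))"
    using assms inverse_power_summable[of 2, where 'a = real] 
    by (intro summable_add) (auto simp: S12_def summable_Suc_iff[of "\<lambda>n. inverse (real n ^ 2)"] simp del: of_nat_Suc)
  fix n
  define x where "x = (real n + 1) * cmod (taylor_coeff f n)"
  define y where "y = inverse (real n + 1)"
  have "2 * (x * y) \<le> x\<^sup>2 + y\<^sup>2"
    using sum_squares_bound[of x y] by simp
  moreover have "x * y = cmod (taylor_coeff f n)"
    by (simp add: x_def y_def)
  moreover have "x\<^sup>2 \<le> (real n + 1) * (real n + 2) * (cmod (taylor_coeff f n))\<^sup>2"
    unfolding x_def power_mult_distrib power2_eq_square[of "real n + 1"] 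
    by (intro mult_right_mono) auto
  ultimately have "cmod (taylor_coeff f n) \<le>
     (real n + 1) * (real n + 2) / 2 * (cmod (taylor_coeff f n))\<^sup>2 + y\<^sup>2 / 2"
    by simp
  also have "\<dots> \<le> (real n + 1) * (real n + 2) / 2 * (cmod (taylor_coeff f n))\<^sup>2 + y\<^sup>2"
    by simp
  finally show "norm (cmod (taylor_coeff f n)) \<le>
     (real n + 1) * (real n + 2) / 2 * (cmod (taylor_coeff f n))\<^sup>2 + inverse (real (Suc n) ^ 2)"
    by (simp add: y_def power_inverse add.commute)
qed

lemma S12_bounded:
  assumes "f \<in> S12" "cmod z < 1"
  shows "cmod (f z) \<le> (\<Sum>n. cmod (taylor_coeff f n))"
proof -
  have "f z = (\<Sum>n. taylor_coeff f n * z ^ n)"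
    using taylor_coeff_sums[OF S12_holomorphic] assms by (simp add: sums_iff)
  also have "cmod \<dots> \<le> (\<Sum>n. cmod (taylor_coeff f n))"
  proof -
    have sm: "summable (\<lambda>n. cmod (taylor_coeff f n))"
      using assms by (intro S12_summable_taylor_coeff)
    have le: "cmod (taylor_coeff f n * z ^ n) \<le> cmod (taylor_coeff f n)" for n
      using assms by (simp add: norm_mult norm_power mult_left_le power_le_one)
    have sm': "summable (\<lambda>n. cmod (taylor_coeff f n * z ^ n))"
      by (rule summable_comparison_test'[OF sm, of 0]) (use le in simp)
    show ?thesis
      using summable_norm[OF sm'] suminf_le[OF le sm' sm] by simp
  qed
  finally show ?thesis .
qed

lemma monomial_in_S12: "(\<lambda>z. z ^ N) \<in> S12"
proof -
  have "taylor_coeff (\<lambda>z. z ^ N) n = (if n = N then 1 else 0)" for n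
    using taylor_coeff_eq_fps_nth[OF has_fps_expansion_fps_X_power, of N n] by simp
  then show ?thesis
    by (auto simp: S12_def if_distrib[of "\<lambda>x. _ * x"] if_distrib[of "\<lambda>x. (cmod x)\<^sup>2"]
        intro!: holomorphic_intros summable_finite[of "{N}"] cong: if_cong)
qed

lemma deriv_holomorphic:
  "f \<in> S12 \<Longrightarrow> deriv f holomorphic_on ball 0 1"
  by (intro holomorphic_deriv S12_holomorphic) auto

lemma hardy_deriv_sums:
  assumes "f \<in> S12"
  shows "(\<lambda>n. (cmod (taylor_coeff (deriv f) n))\<^sup>2) sums (\<Sum>n. (real n)\<^sup>2 * (cmod (taylor_coeff f n))\<^sup>2)"
proof -
  have "(\<lambda>n. (real n)\<^sup>2 * (cmod (taylor_coeff f n))\<^sup>2) sums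
        (\<Sum>n. (real n)\<^sup>2 * (cmod (taylor_coeff f n))\<^sup>2)"
    using S12_summable_power[OF assms, of 2] by (simp add: summable_sums)
  then have "(\<lambda>n. (real (Suc n))\<^sup>2 * (cmod (taylor_coeff f (Suc n)))\<^sup>2) sums
        (\<Sum>n. (real n)\<^sup>2 * (cmod (taylor_coeff f n))\<^sup>2)"
    using sums_Suc_iff[of "\<lambda>n. (real n)\<^sup>2 * (cmod (taylor_coeff f n))\<^sup>2"] by simp
  then show ?thesis
    by (simp add: taylor_coeff_deriv norm_mult power_mult_distrib del: of_nat_Suc)
qed

lemma summable_hardy_deriv:
  "f \<in> S12 \<Longrightarrow> summable (\<lambda>n. (cmod (taylor_coeff (deriv f) n))\<^sup>2)"
  using hardy_deriv_sums by (rule sums_summable)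

lemma hardy_norm_sq_deriv:
  "f \<in> S12 \<Longrightarrow> hardy_norm_sq (deriv f) = (\<Sum>n. (real n)\<^sup>2 * (cmod (taylor_coeff f n))\<^sup>2)"
  using hardy_deriv_sums[of f] by (simp add: hardy_norm_sq_def sums_iff)

lemma summable_hardy:
  "f \<in> S12 \<Longrightarrow> summable (\<lambda>n. (cmod (taylor_coeff f n))\<^sup>2)"
  using S12_summable_power[of f 0] by simp

text \<open>
  This bound and the next one reduce the growth of norms to Hardy norms of derivatives. Only the
  order of growth in \<open>k\<close> will matter, so crude constants suffice.
\<close>

lemma S12_norm_power2_le:
  assumes "f \<in> S12"
  shows "(S12_norm f)\<^sup>2 \<le> hardy_norm_sq f + 2 * hardy_norm_sq (deriv f)"
proof -
  let ?c = "\<lambda>n. (cmod (taylor_coeff f n))\<^sup>2"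
  note sm = summable_hardy[OF assms] S12_summable_power[OF assms, of 2, simplified]
  have "(S12_norm f)\<^sup>2 \<le> (\<Sum>n. ?c n + 2 * ((real n)\<^sup>2 * ?c n))"
    unfolding S12_norm_power2[OF assms]
  proof (rule suminf_le)
    fix n
    have "real n \<le> (real n)\<^sup>2"
      by (cases n) (auto simp: power2_eq_square)
    then have "(real n + 1) * (real n + 2) / 2 \<le> 1 + 2 * (real n)\<^sup>2"
      by (simp add: power2_eq_square algebra_simps)
    then have "(real n + 1) * (real n + 2) / 2 * ?c n \<le> (1 + 2 * (real n)\<^sup>2) * ?c n"
      by (rule mult_right_mono) simp
    then show "(real n + 1) * (real n + 2) / 2 * ?c n \<le> ?c n + 2 * ((real n)\<^sup>2 * ?c n)"
      by (simp add: algebra_simps)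
  qed (use assms sm in \<open>auto simp: S12_def intro!: summable_add summable_mult\<close>)
  also have "\<dots> = hardy_norm_sq f + 2 * hardy_norm_sq (deriv f)"
    unfolding hardy_norm_sq_deriv[OF assms] unfolding hardy_norm_sq_def
    using sm by (simp add: summable_mult suminf_mult flip: suminf_add)
  finally show ?thesis .
qed

lemma hardy_norm_sq_deriv_le:
  assumes "f \<in> S12"
  shows "hardy_norm_sq (deriv f) \<le> 2 * (S12_norm f)\<^sup>2"
proof -
  let ?c = "\<lambda>n. (cmod (taylor_coeff f n))\<^sup>2"
  have sm: "summable (\<lambda>n. (real n + 1) * (real n + 2) / 2 * ?c n)"
    using assms by (simp add: S12_def)
  have "hardy_norm_sq (deriv f) \<le> (\<Sum>n. 2 * ((real n + 1) * (real n + 2) / 2 * ?c n))"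
    unfolding hardy_norm_sq_deriv[OF assms]
  proof (rule suminf_le)
    fix n
    have "(real n)\<^sup>2 \<le> (real n + 1) * (real n + 2)"
      by (simp add: power2_eq_square algebra_simps)
    then show "(real n)\<^sup>2 * ?c n \<le> 2 * ((real n + 1) * (real n + 2) / 2 * ?c n)"
      by (simp add: mult_right_mono)
  qed (use S12_summable_power[OF assms, of 2] sm in \<open>auto intro!: summable_mult\<close>)
  then show ?thesis
    by (simp only: S12_norm_power2[OF assms] suminf_mult[OF sm])
qed

text \<open>
  The \<open>n\<close>-th coefficient moves to place \<open>n + N\<close>, and
  \<open>(n + N + 1) (n + N + 2) / 2 = (n + 1) (n + 2) / 2 + N (n + 3/2) + N\<^sup>2 / 2\<close>.
\<close>

lemma shift_in_S12_norm:
  assumes "f \<in> S12"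
  shows "(\<lambda>z. z ^ N * f z) \<in> S12" (is ?in)
    and "(S12_norm (\<lambda>z. z ^ N * f z))\<^sup>2 =
      (\<Sum>n. (real n + 1) * (real n + 2) / 2 * (cmod (taylor_coeff f n))\<^sup>2)
      + real N * (\<Sum>n. (real n + 3 / 2) * (cmod (taylor_coeff f n))\<^sup>2)
      + (real N)\<^sup>2 * (hardy_norm_sq f / 2)" (is ?norm)
proof -
  let ?c = "\<lambda>n. (cmod (taylor_coeff f n))\<^sup>2"
  let ?w = "\<lambda>n. (real n + 1) * (real n + 2) / 2"
  let ?g = "\<lambda>z. z ^ N * f z"
  let ?t = "\<lambda>n. ?w n * (cmod (taylor_coeff ?g n))\<^sup>2"
  let ?S = "(\<Sum>n. ?w n * ?c n) + real N * (\<Sum>n. (real n + 3 / 2) * ?c n) + (real N)\<^sup>2 * (hardy_norm_sq f / 2)"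
  have c0: "?c sums hardy_norm_sq f"
    using summable_hardy[OF assms] by (simp add: hardy_norm_sq_def summable_sums)
  have "summable (\<lambda>n. real n * ?c n + 3 / 2 * ?c n)"
    using S12_summable_power[OF assms, of 1] S12_summable_power[OF assms, of 0]
    by (intro summable_add summable_mult) auto
  then have c1: "(\<lambda>n. (real n + 3 / 2) * ?c n) sums (\<Sum>n. (real n + 3 / 2) * ?c n)"
    by (simp add: algebra_simps summable_sums)
  have c2: "(\<lambda>n. ?w n * ?c n) sums (\<Sum>n. ?w n * ?c n)"
    using assms by (simp add: S12_def summable_sums)
  have "(\<lambda>n. ?w n * ?c n + real N * ((real n + 3 / 2) * ?c n) + (real N)\<^sup>2 * (?c n / 2)) sums ?S"
    by (intro sums_add sums_mult sums_divide c0 c1 c2)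
  also have "(\<lambda>n. ?w n * ?c n + real N * ((real n + 3 / 2) * ?c n) + (real N)\<^sup>2 * (?c n / 2))
      = (\<lambda>n. ?t (n + N))"
  proof
    fix n
    have "?w n * c + real N * ((real n + 3 / 2) * c) + (real N)\<^sup>2 * (c / 2) = ?w (n + N) * c" for c
      by (simp add: field_simps power2_eq_square)
    moreover have "?c n = (cmod (taylor_coeff ?g (n + N)))\<^sup>2"
      using S12_holomorphic[OF assms] by (simp add: taylor_coeff_shift)
    ultimately show "?w n * ?c n + real N * ((real n + 3 / 2) * ?c n) + (real N)\<^sup>2 * (?c n / 2) = ?t (n + N)"
      by simp
  qed
  finally have "?t sums (?S + (\<Sum>n<N. ?t n))"
    by (subst (asm) sums_iff_shift)
  moreover have "(\<Sum>n<N. ?t n) = 0"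
    using S12_holomorphic[OF assms] by (intro sum.neutral) (auto simp: taylor_coeff_shift)
  ultimately have *: "?t sums ?S"
    by simp
  show ?in
    unfolding S12_def using S12_holomorphic[OF assms] sums_summable[OF *]
    by (auto intro!: holomorphic_intros)
  then show ?norm
    using * by (simp only: S12_norm_power2 sums_iff)
qed

text \<open>
  The second difference, at \<open>0\<close>, of the quadratic polynomial in \<open>N\<close> above. The exponents
  \<open>1\<close> and \<open>0\<close> are left unevaluated so that all three terms have the same shape.
\<close>

lemma hardy_norm_sq_eq_second_difference:
  assumes "f \<in> S12"
  shows "hardy_norm_sq f = (S12_norm (\<lambda>z. z\<^sup>2 * f z))\<^sup>2
     - 2 * (S12_norm (\<lambda>z. z ^ 1 * f z))\<^sup>2 + (S12_norm (\<lambda>z. z ^ 0 * f z))\<^sup>2"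
  unfolding shift_in_S12_norm(2)[OF assms] by simp

section \<open>Finite Blaschke products from boundary behaviour\<close>

text \<open>
  The filter of approach to the unit circle from inside, uniformly in the direction.
\<close>

definition disc_boundary :: "complex filter" where
  "disc_boundary = filtercomap cmod (at_left 1)"

lemma eventually_disc_boundary:
  "eventually P disc_boundary \<longleftrightarrow> (\<exists>r<1. \<forall>z. r < cmod z \<and> cmod z < 1 \<longrightarrow> P z)"
proof -
  have "eventually P disc_boundary \<longleftrightarrow> 
      (\<exists>Q. (\<exists>r<1. \<forall>y>r. y < 1 \<longrightarrow> Q y) \<and> (\<forall>z. Q (cmod z) \<longrightarrow> P z))"
    unfolding disc_boundary_def eventually_filtercomap
    by (subst eventually_at_left[of 0]) auto
  also have "\<dots> \<longleftrightarrow> (\<exists>r<1. \<forall>z. r < cmod z \<and> cmod z < 1 \<longrightarrow> P z)"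
  proof
    assume "\<exists>r<1. \<forall>z. r < cmod z \<and> cmod z < 1 \<longrightarrow> P z"
    then obtain r where "r < 1" "\<forall>z. r < cmod z \<and> cmod z < 1 \<longrightarrow> P z"
      by blast
    then show "\<exists>Q. (\<exists>r<1. \<forall>y>r. y < 1 \<longrightarrow> Q y) \<and> (\<forall>z. Q (cmod z) \<longrightarrow> P z)"
      by (intro exI[of _ "\<lambda>y. r < y \<and> y < 1"]) auto
  qed blast
  finally show ?thesis .
qed

lemma cmod_tendsto_disc_boundary: "(cmod \<longlongrightarrow> 1) disc_boundary"
proof -
  have "filterlim cmod (at_left 1) disc_boundary"
    unfolding disc_boundary_def by (rule filterlim_filtercomap)
  then show ?thesis
    by (rule tendsto_mono[OF at_le, of "{..<1}" UNIV, simplified, THEN filterlim_compose, rotated])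
       (auto intro: tendsto_ident_at)
qed

lemma eventually_in_disc: "\<forall>\<^sub>F z in disc_boundary. cmod z < 1"
  unfolding eventually_disc_boundary by (auto intro: exI[of _ 0])

lemma cmod_le_1_of_boundary:
  assumes "f holomorphic_on ball 0 1" "((\<lambda>z. cmod (f z)) \<longlongrightarrow> 1) disc_boundary" "cmod z < 1"
  shows "cmod (f z) \<le> 1"
proof (rule field_le_epsilon)
  fix e :: real
  assume "e > 0"
  then have "\<forall>\<^sub>F z in disc_boundary. cmod (f z) < 1 + e"
    using assms(2) by (intro order_tendstoD(2)) auto
  then obtain r where r: "r < 1" "\<And>z. r < cmod z \<Longrightarrow> cmod z < 1 \<Longrightarrow> cmod (f z) < 1 + e"
    unfolding eventually_disc_boundary by blast
  obtain s where s: "max r (cmod z) < s" "s < 1"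
    using dense[of "max r (cmod z)" 1] r assms(3) by auto
  have "s > 0" using s norm_ge_zero[of z] by linarith
  show "cmod (f z) \<le> 1 + e"
  proof (rule maximum_modulus_frontier[of f "cball 0 s"])
    show "f holomorphic_on interior (cball 0 s)"
      using s by (intro holomorphic_on_subset[OF assms(1)]) auto
    show "continuous_on (closure (cball 0 s)) f"
      using s by (intro holomorphic_on_imp_continuous_on holomorphic_on_subset[OF assms(1)]) auto
    show "cmod (f w) \<le> 1 + e" if "w \<in> frontier (cball 0 s)" for w
      using that s r(2)[of w] \<open>s > 0\<close> by (auto simp: less_imp_le)
  qed (use s in auto)
qed

text \<open>
  The maximum principle applies to \<open>f\<close> and to \<open>1 / f\<close>, so \<open>\<bar>f\<bar> = 1\<close> throughout the disc.
\<close>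

lemma zero_free_inner_constant:
  assumes "f holomorphic_on ball 0 1" "((\<lambda>z. cmod (f z)) \<longlongrightarrow> 1) disc_boundary"
    and nz: "\<And>z. cmod z < 1 \<Longrightarrow> f z \<noteq> 0"
  obtains c where "cmod c = 1" "\<And>z. cmod z < 1 \<Longrightarrow> f z = c"
proof -
  have unit: "cmod (f z) = 1" if "cmod z < 1" for z
  proof (rule antisym)
    show "cmod (f z) \<le> 1"
      using assms that by (intro cmod_le_1_of_boundary) auto
    have "((\<lambda>z. inverse (cmod (f z))) \<longlongrightarrow> inverse 1) disc_boundary"
      by (intro tendsto_inverse assms) auto
    then have "cmod (inverse (f z)) \<le> 1"
      using assms that
      by (intro cmod_le_1_of_boundary holomorphic_intros) (auto simp: norm_inverse)
    then show "1 \<le> cmod (f z)"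
      using nz[OF that] by (simp add: norm_inverse inverse_le_1_iff)
  qed
  have "f constant_on ball 0 1"
    by (rule maximum_modulus_principle[where U = "ball 0 1" and \<xi> = 0])
       (use assms unit in auto)
  then obtain c where c: "\<And>z. z \<in> ball 0 1 \<Longrightarrow> f z = c"
    by (auto simp: constant_on_def)
  show ?thesis
    by (rule that[of c]) (use c unit[of 0] in auto)
qed

lemma one_minus_cnj_mult_nonzero:
  assumes "cmod a < 1" "cmod z \<le> 1"
  shows "1 - cnj a * z \<noteq> 0"
proof
  assume "1 - cnj a * z = 0"
  then have "cmod (cnj a * z) = 1" by simp
  moreover have "cmod (cnj a * z) \<le> cmod a * 1"
    unfolding norm_mult complex_mod_cnj by (intro mult_left_mono assms) auto
  ultimately show False using assms by simp
qed

text \<open>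
  The defect of a Blaschke factor is
  \<open>1 - \<bar>b\<^sub>a z\<bar>\<^sup>2 = (1 - \<bar>a\<bar>\<^sup>2) (1 - \<bar>z\<bar>\<^sup>2) / \<bar>1 - cnj a \<cdot> z\<bar>\<^sup>2\<close>, where the denominator is at least
  \<open>(1 - \<bar>a\<bar>)\<^sup>2\<close>.
\<close>

lemma cmod_blaschke_factor_tendsto:
  assumes "cmod a < 1"
  shows "((\<lambda>z. cmod ((z - a) / (1 - cnj a * z))) \<longlongrightarrow> 1) disc_boundary"
proof -
  define d where "d = (\<lambda>z. (1 - (cmod a)\<^sup>2) * (1 - (cmod z)\<^sup>2) / (cmod (1 - cnj a * z))\<^sup>2)"
  have sq: "(cmod ((z - a) / (1 - cnj a * z)))\<^sup>2 = 1 - d z" if "cmod z < 1" for z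
  proof -
    have "(cmod (1 - cnj a * z))\<^sup>2 - (cmod (z - a))\<^sup>2 = (1 - (cmod a)\<^sup>2) * (1 - (cmod z)\<^sup>2)"
      unfolding cmod_power2 by (simp add: power2_eq_square algebra_simps)
    moreover have "1 - cnj a * z \<noteq> 0"
      using one_minus_cnj_mult_nonzero assms that by simp
    ultimately show ?thesis
      by (simp add: d_def norm_divide power_divide field_simps)
  qed
  have d0: "(d \<longlongrightarrow> 0) disc_boundary"
  proof (rule Lim_null_comparison)
    show "\<forall>\<^sub>F z in disc_boundary. norm (d z) \<le> (1 - (cmod z)\<^sup>2) / (1 - cmod a)\<^sup>2"
      using eventually_in_disc
    proof eventually_elim
      case (elim z)
      have "cmod (cnj a * z) \<le> cmod a * 1"
        unfolding norm_mult complex_mod_cnj using elim by (intro mult_left_mono) auto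
      then have "1 - cmod a \<le> cmod (1 - cnj a * z)"
        using norm_triangle_ineq2[of 1 "cnj a * z"] by simp
      then have "(1 - cmod a)\<^sup>2 \<le> (cmod (1 - cnj a * z))\<^sup>2"
        using assms by (intro power_mono) auto
      moreover have "0 \<le> 1 - (cmod z)\<^sup>2" "0 \<le> 1 - (cmod a)\<^sup>2" "1 - (cmod a)\<^sup>2 \<le> 1"
        using elim assms by (auto simp: abs_square_le_1)
      ultimately show ?case
        using assms unfolding d_def by (simp add: abs_mult) (intro frac_le mult_left_le_one_le mult_nonneg_nonneg; simp)
    qed
    have "((\<lambda>z. (1 - (cmod z)\<^sup>2) / (1 - cmod a)\<^sup>2) \<longlongrightarrow> (1 - 1\<^sup>2) / (1 - cmod a)\<^sup>2) disc_boundary"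
      using assms by (intro tendsto_intros cmod_tendsto_disc_boundary) auto
    then show "((\<lambda>z. (1 - (cmod z)\<^sup>2) / (1 - cmod a)\<^sup>2) \<longlongrightarrow> 0) disc_boundary"
      by simp
  qed
  have "((\<lambda>z. sqrt (1 - d z)) \<longlongrightarrow> sqrt (1 - 0)) disc_boundary"
    by (intro tendsto_intros d0)
  moreover have "\<forall>\<^sub>F z in disc_boundary. sqrt (1 - d z) = cmod ((z - a) / (1 - cnj a * z))"
    using eventually_in_disc by eventually_elim (simp flip: sq)
  ultimately show ?thesis
    by (simp add: filterlim_cong)
qed

text \<open>
  The zero \<open>a\<close> is removed with its full multiplicity \<open>n\<close>, so that the quotient has one zero
  fewer as a point of the disc. The local factorisation at \<open>a\<close> fills in the value of the quotient
  there.
\<close>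

lemma divide_out_blaschke_factor:
  assumes holf: "f holomorphic_on ball 0 1" and a: "cmod a < 1" "f a = 0"
    and nonconst: "\<not> f constant_on ball 0 1"
  obtains g n where "g holomorphic_on ball 0 1" "g a \<noteq> 0"
    "\<And>z. cmod z < 1 \<Longrightarrow> f z = ((z - a) / (1 - cnj a * z)) ^ n * g z"
proof -
  obtain h r n where h: "0 < n" "0 < r" "ball a r \<subseteq> ball 0 1" "h holomorphic_on ball a r"
      "\<And>w. w \<in> ball a r \<Longrightarrow> f w = (w - a) ^ n * h w" "\<And>w. w \<in> ball a r \<Longrightarrow> h w \<noteq> 0"
  proof (rule holomorphic_factor_zero_nonconstant[of f "ball 0 1" a])
  qed (use holf a nonconst in auto)
  define q where "q = (\<lambda>z. if z = a then h a else f z / (z - a) ^ n)"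
  define g where "g = (\<lambda>z. q z * (1 - cnj a * z) ^ n)"
  have "q holomorphic_on ball a r"
    by (rule holomorphic_transform[OF h(4)]) (auto simp: q_def h(5))
  moreover have "q holomorphic_on ball 0 1 - {a}"
  proof (rule holomorphic_transform)
    show "(\<lambda>z. f z / (z - a) ^ n) holomorphic_on ball 0 1 - {a}"
      by (intro holomorphic_intros holomorphic_on_subset[OF holf]) auto
  qed (auto simp: q_def)
  ultimately have "q holomorphic_on ball a r \<union> (ball 0 1 - {a})"
    by (intro holomorphic_on_Un) auto
  moreover have "ball a r \<union> (ball 0 1 - {a}) = ball 0 1"
    using h(2,3) by auto
  ultimately have "q holomorphic_on ball 0 1"
    by simp
  then have "g holomorphic_on ball 0 1"
    unfolding g_def by (intro holomorphic_intros)
  moreover have "g a \<noteq> 0"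
    using h(2,6) one_minus_cnj_mult_nonzero[OF a(1), of a] a(1) by (simp add: g_def q_def)
  moreover have "f z = ((z - a) / (1 - cnj a * z)) ^ n * g z" if "cmod z < 1" for z
    using one_minus_cnj_mult_nonzero[OF a(1), of z] that a h(1)
    by (cases "z = a") (auto simp: g_def q_def power_divide)
  ultimately show ?thesis using that by blast
qed

text \<open>
  Induction on the number of distinct zeros. There are finitely many because the zeros stay away from
  the circle, and each step divides one of them out without changing the boundary behaviour.
\<close>

lemma finite_blaschke_product_of_boundary:
  assumes "f holomorphic_on ball 0 1" "((\<lambda>z. cmod (f z)) \<longlongrightarrow> 1) disc_boundary"
  shows "finite_blaschke_product f"
  using assms
proof (induction "card {z \<in> ball 0 1. f z = 0}" arbitrary: f rule: less_induct)
  case less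
  note holf = less.prems(1)
  show ?case
  proof (cases "\<exists>a. cmod a < 1 \<and> f a = 0")
    case False
    then obtain c where c: "cmod c = 1" "\<And>z. cmod z < 1 \<Longrightarrow> f z = c"
      using zero_free_inner_constant[OF less.prems] by metis
    then show ?thesis
      unfolding finite_blaschke_product_def by (intro exI[of _ c] exI[of _ "[]"]) simp
  next
    case True
    then obtain a where a: "cmod a < 1" "f a = 0" by blast
    have "\<forall>\<^sub>F z in disc_boundary. cmod (f z) > 0"
      using less.prems(2) by (rule order_tendstoD) simp
    then obtain r where r: "r < 1" "\<And>z. r < cmod z \<Longrightarrow> cmod z < 1 \<Longrightarrow> f z \<noteq> 0"
      unfolding eventually_disc_boundary by auto
    obtain s where s: "max r 0 < s" "s < 1"
      using dense[of "max r 0" 1] r by auto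
    have nonconst: "\<not> f constant_on ball 0 1"
    proof
      assume "f constant_on ball 0 1"
      then have "f (of_real s) = f a"
        using s a by (auto simp: constant_on_def)
      then show False
        using r(2)[of "of_real s"] s a by simp
    qed
    have "finite {z \<in> cball 0 s. f z = 0}"
      by (rule holomorphic_compact_finite_zeros[OF holf]) (use s nonconst in auto)
    moreover have "{z \<in> ball 0 1. f z = 0} \<subseteq> {z \<in> cball 0 s. f z = 0}"
      using r(2) s by (force simp: not_less[symmetric])
    ultimately have fin: "finite {z \<in> ball 0 1. f z = 0}"
      by (rule finite_subset[rotated])
    obtain g n where g: "g holomorphic_on ball 0 1" "g a \<noteq> 0"
      and fg: "\<And>z. cmod z < 1 \<Longrightarrow> f z = ((z - a) / (1 - cnj a * z)) ^ n * g z"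
      using divide_out_blaschke_factor[OF holf a nonconst] by blast
    have "((\<lambda>z. cmod (f z) / cmod ((z - a) / (1 - cnj a * z)) ^ n) \<longlongrightarrow> 1 / 1 ^ n) disc_boundary"
      using a by (intro tendsto_intros less.prems(2) cmod_blaschke_factor_tendsto) auto
    moreover have "\<forall>\<^sub>F z in disc_boundary. 
        cmod (f z) / cmod ((z - a) / (1 - cnj a * z)) ^ n = cmod (g z)"
      using eventually_in_disc order_tendstoD(1)[OF cmod_blaschke_factor_tendsto[OF a(1)], of 0, OF zero_less_one]
    proof eventually_elim
      case (elim z)
      show ?case
        unfolding fg[OF elim(1)] norm_mult norm_power using elim(2) by simp
    qed
    ultimately have limg: "((\<lambda>z. cmod (g z)) \<longlongrightarrow> 1) disc_boundary"
      by (simp add: filterlim_cong)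
    have "{z \<in> ball 0 1. g z = 0} \<subset> {z \<in> ball 0 1. f z = 0}"
      using a g(2) fg by auto
    then have "card {z \<in> ball 0 1. g z = 0} < card {z \<in> ball 0 1. f z = 0}"
      using fin by (rule psubset_card_mono[rotated])
    then have "finite_blaschke_product g"
      using g(1) limg by (rule less.hyps)
    then obtain c as where c: "cmod c = 1" "set as \<subseteq> ball 0 1"
      "\<And>z. z \<in> ball 0 1 \<Longrightarrow> g z = c * (\<Prod>a\<leftarrow>as. (z - a) / (1 - cnj a * z))"
      unfolding finite_blaschke_product_def by blast
    have "f z = c * (\<Prod>b\<leftarrow>replicate n a @ as. (z - b) / (1 - cnj b * z))" if "z \<in> ball 0 1" for z
      using fg[of z] c(3)[OF that] that by (simp add: prod_list_replicate)
    moreover have "set (replicate n a @ as) \<subseteq> ball 0 1"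
      using c(2) a(1) by auto
    ultimately show ?thesis
      unfolding finite_blaschke_product_def using c(1) by blast
  qed
qed

section \<open>Unimodular boundary values of the symbol\<close>

text \<open>
  The values of \<open>f\<close> itself on the unit circle are arbitrary; its Taylor series supplies the
  continuous extension from the disc.
\<close>

definition boundary_ext :: "(complex \<Rightarrow> complex) \<Rightarrow> complex \<Rightarrow> complex" where
  "boundary_ext f z = (\<Sum>n. taylor_coeff f n * z ^ n)"

lemma boundary_ext_eq:
  assumes "f holomorphic_on ball 0 1" "cmod z < 1"
  shows "boundary_ext f z = f z"
  using taylor_coeff_sums[OF assms] by (simp add: boundary_ext_def sums_iff)

lemma continuous_on_boundary_ext:
  assumes "f \<in> S12"
  shows "continuous_on (cball 0 1) (boundary_ext f)"
proof (rule uniform_limit_theorem)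
  show "uniform_limit (cball 0 1) (\<lambda>N z. \<Sum>n<N. taylor_coeff f n * z ^ n) (boundary_ext f) sequentially"
    unfolding boundary_ext_def
  proof (rule Weierstrass_m_test)
    fix n and z :: complex
    assume "z \<in> cball 0 1"
    then show "norm (taylor_coeff f n * z ^ n) \<le> cmod (taylor_coeff f n)"
      by (simp add: norm_mult norm_power mult_left_le power_le_one)
  qed (rule S12_summable_taylor_coeff[OF assms])
qed (auto intro!: always_eventually continuous_intros)

text \<open>
  Both sides are continuous on the closed disc and agree inside it.
\<close>

lemma boundary_ext_power:
  assumes "f \<in> S12" "(\<lambda>z. f z ^ k) \<in> S12" "cmod z \<le> 1"
  shows "boundary_ext (\<lambda>z. f z ^ k) z = boundary_ext f z ^ k"
proof -
  have "boundary_ext (\<lambda>z. f z ^ k) z - boundary_ext f z ^ k = 0"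
  proof (rule continuous_constant_on_closure
        [of "ball 0 1" "\<lambda>z. boundary_ext (\<lambda>z. f z ^ k) z - boundary_ext f z ^ k"])
    show "continuous_on (closure (ball 0 1)) (\<lambda>z. boundary_ext (\<lambda>z. f z ^ k) z - boundary_ext f z ^ k)"
      using assms by (auto intro!: continuous_intros continuous_on_boundary_ext)
    show "boundary_ext (\<lambda>z. f z ^ k) w - boundary_ext f w ^ k = 0" if "w \<in> ball 0 1" for w
      using that assms by (simp add: boundary_ext_eq S12_holomorphic)
  qed (use assms in auto)
  then show ?thesis by simp
qed

lemma boundary_ext_circle_integral:
  assumes "f \<in> S12"
  shows "((\<lambda>t. (cmod (boundary_ext f (cis t)))\<^sup>2) has_integral 2 * pi * hardy_norm_sq f) {0..2 * pi}"
  using parseval[OF S12_summable_taylor_coeff[OF assms]]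
  by (simp add: boundary_ext_def hardy_norm_sq_def Complex.DeMoivre)

lemma mult_operator_funpow:
  "(mult_operator \<psi> ^^ k) h = (\<lambda>z. \<psi> z ^ k * h z)"
  by (induction k) (auto simp: mult_operator_def mult_ac)

lemma power_mult_in_S12:
  assumes "bounded_operator_S12 (mult_operator \<psi>)" "h \<in> S12"
  shows "(\<lambda>z. \<psi> z ^ k * h z) \<in> S12"
proof -
  have "(mult_operator \<psi> ^^ k) h \<in> S12"
    using assms by (induction k) (auto simp: bounded_operator_S12_def)
  then show ?thesis by (simp add: mult_operator_funpow)
qed

text \<open>
  The definition gives the difference at \<open>j = 0\<close> only; replacing \<open>h\<close> by \<open>\<psi>\<^sup>j h\<close> gives it at
  every \<open>j\<close>.
\<close>

lemma m_isometry_iff_fdiff: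
  "m_isometry m (mult_operator \<psi>) \<longleftrightarrow> bounded_operator_S12 (mult_operator \<psi>) \<and>
     (\<forall>h\<in>S12. \<forall>j. (fdiff ^^ m) (\<lambda>k. (S12_norm (\<lambda>z. \<psi> z ^ k * h z))\<^sup>2) j = 0)"
proof -
  have "(fdiff ^^ m) (\<lambda>k. (S12_norm (\<lambda>z. \<psi> z ^ k * h z))\<^sup>2) j = 0"
    if iso: "m_isometry m (mult_operator \<psi>)" and "h \<in> S12" for h j
  proof -
    have "(\<lambda>z. \<psi> z ^ j * h z) \<in> S12"
      using that by (intro power_mult_in_S12) (auto simp: m_isometry_def)
    with iso have "(\<Sum>k=0..m. (-1) ^ (m - k) * real (m choose k) *
        (S12_norm (\<lambda>z. \<psi> z ^ k * (\<psi> z ^ j * h z)))\<^sup>2) = 0"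
      by (auto simp: m_isometry_def mult_operator_funpow)
    then show ?thesis
      unfolding fdiff_funpow_eq_sum by (simp add: power_add mult_ac)
  qed
  moreover have "m_isometry m (mult_operator \<psi>)"
    if "bounded_operator_S12 (mult_operator \<psi>)"
      and diff: "\<And>h. h \<in> S12 \<Longrightarrow> (fdiff ^^ m) (\<lambda>k. (S12_norm (\<lambda>z. \<psi> z ^ k * h z))\<^sup>2) 0 = 0"
    using that(1) diff[unfolded fdiff_funpow_eq_sum]
    by (simp add: m_isometry_def mult_operator_funpow)
  ultimately show ?thesis
    by (metis (no_types, lifting) m_isometry_def)
qed

lemma fdiff_funpow_linear:
  "(fdiff ^^ m) (\<lambda>k. a * p k + b * q k + c * r k) j =
    a * (fdiff ^^ m) p j + b * (fdiff ^^ m) q j + c * (fdiff ^^ m) r j"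
proof (induction m arbitrary: j)
  case (Suc m)
  show ?case
    unfolding fdiff_funpow_Suc Suc.IH by (simp add: algebra_simps)
qed simp

text \<open>
  Apply the \<open>m\<close>-isometry to \<open>h = 1, z, z\<^sup>2\<close> and take the second difference in the exponent of
  \<open>z\<close>.
\<close>

lemma hardy_m_isometry:
  assumes "m_isometry m (mult_operator \<psi>)"
  shows "(fdiff ^^ m) (\<lambda>k. hardy_norm_sq (\<lambda>z. \<psi> z ^ k)) j = 0"
proof -
  let ?p = "\<lambda>N k. (S12_norm (\<lambda>z. \<psi> z ^ k * z ^ N))\<^sup>2"
  have "(fdiff ^^ m) (?p N) j = 0" for N
    using bspec[OF conjunct2[OF assms[unfolded m_isometry_iff_fdiff]] monomial_in_S12[of N]] by simp
  moreover have "hardy_norm_sq (\<lambda>z. \<psi> z ^ k) = 1 * ?p 2 k + (- 2) * ?p 1 k + 1 * ?p 0 k" for k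
  proof -
    have "(\<lambda>z. \<psi> z ^ k) \<in> S12"
      using power_mult_in_S12[of \<psi> "\<lambda>z. z ^ 0" k] assms monomial_in_S12[of 0]
      by (simp add: m_isometry_def)
    from hardy_norm_sq_eq_second_difference[OF this] show ?thesis
      by (simp add: mult_ac)
  qed
  ultimately show ?thesis
    by (simp only: fdiff_funpow_linear)
qed

text \<open>
  By Parseval's identity and the binomial theorem, \<open>\<integral> (\<bar>\<psi>\<bar>\<^sup>2 - 1)\<^sup>M = 0\<close> over the unit circle. For
  even \<open>M\<close> the integrand is continuous and nonnegative, hence zero.
\<close>

lemma boundary_ext_unimodular:
  assumes "\<psi> \<in> S12" and iso: "m_isometry m (mult_operator \<psi>)" and "cmod z = 1"
  shows "cmod (boundary_ext \<psi> z) = 1"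
proof -
  let ?u = "\<lambda>t. (cmod (boundary_ext \<psi> (cis t)))\<^sup>2"
  \<comment> \<open>any even number that is at least \<open>m\<close> will do\<close>
  define M where "M = 2 * m"
  have in_S12: "(\<lambda>z. \<psi> z ^ k) \<in> S12" for k
    using power_mult_in_S12[of \<psi> "\<lambda>z. z ^ 0" k] iso monomial_in_S12[of 0]
    by (simp add: m_isometry_def)
  have mean: "((\<lambda>t. ?u t ^ k) has_integral 2 * pi * hardy_norm_sq (\<lambda>z. \<psi> z ^ k)) {0..2 * pi}" for k
    using boundary_ext_circle_integral[OF in_S12[of k]] boundary_ext_power[OF assms(1) in_S12[of k]]
    by (simp add: norm_power power_mult[symmetric] mult.commute)
  have "((\<lambda>t. \<Sum>k=0..M. (-1) ^ (M - k) * real (M choose k) * ?u t ^ k) has_integral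
     (\<Sum>k=0..M. (-1) ^ (M - k) * real (M choose k) * (2 * pi * hardy_norm_sq (\<lambda>z. \<psi> z ^ k)))) {0..2 * pi}"
    by (intro has_integral_sum has_integral_mult_right mean) auto
  also have "(\<Sum>k=0..M. (-1) ^ (M - k) * real (M choose k) * (2 * pi * hardy_norm_sq (\<lambda>z. \<psi> z ^ k)))
     = 2 * pi * (fdiff ^^ M) (\<lambda>k. hardy_norm_sq (\<lambda>z. \<psi> z ^ k)) 0"
    by (simp add: fdiff_funpow_eq_sum sum_distrib_left mult_ac)
  also have "(fdiff ^^ M) (\<lambda>k. hardy_norm_sq (\<lambda>z. \<psi> z ^ k)) 0 = 0"
    by (rule fdiff_funpow_eq_0_mono[OF hardy_m_isometry[OF iso]]) (simp add: M_def)
  also have "(\<lambda>t. \<Sum>k=0..M. (-1) ^ (M - k) * real (M choose k) * ?u t ^ k) = (\<lambda>t. (?u t - 1) ^ M)"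
  proof
    fix t
    show "(\<Sum>k=0..M. (-1) ^ (M - k) * real (M choose k) * ?u t ^ k) = (?u t - 1) ^ M"
      using binomial_ring[of "?u t" "-1" M] by (simp add: atLeast0AtMost mult_ac)
  qed
  finally have int0: "((\<lambda>t. (?u t - 1) ^ M) has_integral 0) (cbox 0 (2 * pi))"
    by simp
  have "continuous_on (cbox 0 (2 * pi)) (\<lambda>t. boundary_ext \<psi> (cis t))"
    by (rule continuous_on_compose2[OF continuous_on_boundary_ext[OF assms(1)]])
       (auto intro!: continuous_intros)
  then have cont: "continuous_on (cbox 0 (2 * pi)) (\<lambda>t. (?u t - 1) ^ M)"
    by (intro continuous_intros)
  have zero: "(?u t - 1) ^ M = 0" if "t \<in> cbox 0 (2 * pi)" for t
    by (rule has_integral_0_cbox_imp_0[OF cont _ int0 _ that])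
       (auto simp: M_def power_mult not_le)
  obtain t where t: "0 \<le> t" "t < 2 * pi" "z = cis t"
    using Arg2pi[of z] assms(3) by (auto simp: is_Arg_def cis_conv_exp)
  then have "?u t = 1"
    using zero[of t] by simp
  then show ?thesis
    using t power2_eq_imp_eq[of "cmod (boundary_ext \<psi> z)" 1] by simp
qed

text \<open>
  Uniform continuity of the extension on the closed disc, comparing \<open>z\<close> with its radial projection
  \<open>sgn z\<close>.
\<close>

lemma cmod_tendsto_1_of_boundary_ext:
  assumes "\<psi> \<in> S12" and unimod: "\<And>z. cmod z = 1 \<Longrightarrow> cmod (boundary_ext \<psi> z) = 1"
  shows "((\<lambda>z. cmod (\<psi> z)) \<longlongrightarrow> 1) disc_boundary"
proof (rule tendstoI)
  fix e :: real
  assume "e > 0"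
  have "uniformly_continuous_on (cball 0 1) (boundary_ext \<psi>)"
    by (intro compact_uniformly_continuous continuous_on_boundary_ext assms) auto
  then obtain d where d: "d > 0" "\<And>z w. z \<in> cball 0 1 \<Longrightarrow> w \<in> cball 0 1 \<Longrightarrow> dist w z < d \<Longrightarrow>
      dist (boundary_ext \<psi> w) (boundary_ext \<psi> z) < e"
    using \<open>e > 0\<close> unfolding uniformly_continuous_on_def by metis
  have "dist (cmod (\<psi> z)) 1 < e" if z: "max 0 (1 - d) < cmod z" "cmod z < 1" for z
  proof -
    have "z - sgn z = of_real (cmod z - 1) * sgn z"
      using z by (auto simp: sgn_eq field_simps)
    then have "dist z (sgn z) = 1 - cmod z"
      using z unfolding dist_norm by (simp only: norm_mult norm_of_real) (auto simp: norm_sgn)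
    then have "dist (boundary_ext \<psi> z) (boundary_ext \<psi> (sgn z)) < e"
      using z by (intro d) (auto simp: norm_sgn)
    moreover have "cmod (boundary_ext \<psi> (sgn z)) = 1"
      using z by (intro unimod) (auto simp: norm_sgn)
    moreover have "boundary_ext \<psi> z = \<psi> z"
      using z assms by (simp add: boundary_ext_eq S12_holomorphic)
    ultimately show ?thesis
      using norm_triangle_ineq3[of "\<psi> z" "boundary_ext \<psi> (sgn z)"] by (simp add: dist_norm)
  qed
  then show "\<forall>\<^sub>F z in disc_boundary. dist (cmod (\<psi> z)) 1 < e"
    unfolding eventually_disc_boundary using d(1) by (intro exI[of _ "max 0 (1 - d)"]) auto
qed

section \<open>Growth of the norms of powers\<close>

definition hardy :: "(complex \<Rightarrow> complex) set" where
  "hardy = {f. f holomorphic_on ball 0 1 \<and> summable (\<lambda>n. (cmod (taylor_coeff f n))\<^sup>2)}"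

lemma circle_sum_le:
  assumes "f \<in> hardy" "0 \<le> r" "r < 1"
  shows "summable (\<lambda>n. (cmod (taylor_coeff f n) * r ^ n)\<^sup>2)"
    and "(\<Sum>n. (cmod (taylor_coeff f n) * r ^ n)\<^sup>2) \<le> hardy_norm_sq f"
proof -
  have le: "(cmod (taylor_coeff f n) * r ^ n)\<^sup>2 \<le> (cmod (taylor_coeff f n))\<^sup>2" for n
    using assms by (intro power_mono mult_left_le) (auto simp: power_le_one)
  have sm: "summable (\<lambda>n. (cmod (taylor_coeff f n))\<^sup>2)"
    using assms by (simp add: hardy_def)
  show sm': "summable (\<lambda>n. (cmod (taylor_coeff f n) * r ^ n)\<^sup>2)"
    by (rule summable_comparison_test'[OF sm, of 0]) (use le in simp)
  show "(\<Sum>n. (cmod (taylor_coeff f n) * r ^ n)\<^sup>2) \<le> hardy_norm_sq f"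
    unfolding hardy_norm_sq_def by (rule suminf_le[OF le sm' sm])
qed

lemma hardy_norm_sq_nonneg: "f \<in> hardy \<Longrightarrow> 0 \<le> hardy_norm_sq f"
  unfolding hardy_norm_sq_def hardy_def by (auto intro: suminf_nonneg)

text \<open>
  A comparison of moduli near the circle carries over to Hardy norms, because the circle means
  \<open>\<Sum> \<bar>f\<^sub>n\<bar>\<^sup>2 r\<^sup>2\<^sup>n\<close> tend to the squared Hardy norm as \<open>r\<close> tends to \<open>1\<close>. Working inside the disc
  makes this applicable to derivatives of functions in \<open>S12\<close>, which in general have no continuous
  extension to the circle. The factor \<open>c < 1\<close> lets the comparison be merely asymptotic, as it is when
  \<open>\<bar>\<psi>\<bar>\<close> tends to \<open>1\<close>. Two terms on the right accommodate the product rule.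
\<close>

lemma hardy_norm_sq_le_of_boundary:
  assumes "f \<in> hardy" "g \<in> hardy" "h \<in> hardy" "a \<ge> 0" "b \<ge> 0"
    and le: "\<And>c. 0 < c \<Longrightarrow> c < 1 \<Longrightarrow> \<forall>\<^sub>F z in disc_boundary.
        c * (cmod (f z))\<^sup>2 \<le> a * (cmod (g z))\<^sup>2 + b * (cmod (h z))\<^sup>2"
  shows "hardy_norm_sq f \<le> a * hardy_norm_sq g + b * hardy_norm_sq h" (is "_ \<le> ?R")
proof -
  let ?s = "\<lambda>f r n. (cmod (taylor_coeff f n) * r ^ n)\<^sup>2"
  have holo: "f holomorphic_on ball 0 1" "g holomorphic_on ball 0 1" "h holomorphic_on ball 0 1"
    using assms by (auto simp: hardy_def)
  have partial: "c * (\<Sum>n<N. (cmod (taylor_coeff f n))\<^sup>2) \<le> ?R" if c: "0 < c" "c < 1" for c N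
  proof (rule tendsto_upperbound)
    have "((\<lambda>r. c * (\<Sum>n<N. ?s f r n)) \<longlongrightarrow> c * (\<Sum>n<N. ?s f 1 n)) (at_left 1)"
      by (intro tendsto_intros)
    then show "((\<lambda>r. c * (\<Sum>n<N. ?s f r n)) \<longlongrightarrow> c * (\<Sum>n<N. (cmod (taylor_coeff f n))\<^sup>2)) (at_left 1)"
      by simp
    obtain r0 where r0: "r0 < 1" "\<And>z. r0 < cmod z \<Longrightarrow> cmod z < 1 \<Longrightarrow>
        c * (cmod (f z))\<^sup>2 \<le> a * (cmod (g z))\<^sup>2 + b * (cmod (h z))\<^sup>2"
      using le[OF c] unfolding eventually_disc_boundary by blast
    have "c * (\<Sum>n<N. ?s f r n) \<le> ?R" if r: "max 0 r0 < r" "r < 1" for r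
    proof -
      have "c * (2 * pi * (\<Sum>n. ?s f r n)) \<le> a * (2 * pi * (\<Sum>n. ?s g r n)) + b * (2 * pi * (\<Sum>n. ?s h r n))"
      proof (rule has_integral_le)
        show "((\<lambda>t. c * (cmod (f (of_real r * cis t)))\<^sup>2) has_integral c * (2 * pi * (\<Sum>n. ?s f r n))) {0..2 * pi}"
          using r by (intro has_integral_mult_right circle_mean_eq holo) auto
        show "((\<lambda>t. a * (cmod (g (of_real r * cis t)))\<^sup>2 + b * (cmod (h (of_real r * cis t)))\<^sup>2) has_integral 
            a * (2 * pi * (\<Sum>n. ?s g r n)) + b * (2 * pi * (\<Sum>n. ?s h r n))) {0..2 * pi}"
          using r by (intro has_integral_add has_integral_mult_right circle_mean_eq holo) auto
      qed (use r in \<open>auto intro!: r0(2) simp: norm_mult\<close>)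
      then have "2 * pi * (c * (\<Sum>n. ?s f r n)) \<le> 2 * pi * (a * (\<Sum>n. ?s g r n) + b * (\<Sum>n. ?s h r n))"
        by (simp add: algebra_simps)
      then have "c * (\<Sum>n. ?s f r n) \<le> a * (\<Sum>n. ?s g r n) + b * (\<Sum>n. ?s h r n)"
        by (rule mult_left_le_imp_le) simp
      moreover have "c * (\<Sum>n<N. ?s f r n) \<le> c * (\<Sum>n. ?s f r n)"
        using c r assms(1) by (intro mult_left_mono sum_le_suminf circle_sum_le) auto
      moreover have "a * (\<Sum>n. ?s g r n) \<le> a * hardy_norm_sq g" "b * (\<Sum>n. ?s h r n) \<le> b * hardy_norm_sq h"
        using r assms by (auto intro!: mult_left_mono circle_sum_le)
      ultimately show ?thesis by linarith
    qed
    then show "\<forall>\<^sub>F r in at_left 1. c * (\<Sum>n<N. ?s f r n) \<le> ?R"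
      unfolding eventually_at_left[OF zero_less_one] using r0(1) 
      by (intro exI[of _ "max 0 r0"]) auto
  qed simp
  have "c * hardy_norm_sq f \<le> ?R" if "0 < c" "c < 1" for c
  proof -
    have "(\<lambda>N. c * (\<Sum>n<N. (cmod (taylor_coeff f n))\<^sup>2)) \<longlonglongrightarrow> c * hardy_norm_sq f"
      using assms(1) unfolding hardy_norm_sq_def hardy_def by (intro tendsto_intros summable_LIMSEQ) auto
    then show ?thesis
      by (rule tendsto_upperbound) (auto intro!: always_eventually partial that)
  qed
  then show ?thesis
    by (rule field_le_mult_one_interval)
qed

lemma S12_subset_hardy: "f \<in> S12 \<Longrightarrow> f \<in> hardy"
  by (simp add: hardy_def S12_holomorphic summable_hardy)

lemma deriv_in_hardy: "f \<in> S12 \<Longrightarrow> deriv f \<in> hardy"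
  by (simp add: hardy_def deriv_holomorphic summable_hardy_deriv)

text \<open>
  For \<open>k = 0\<close> the truncated exponent \<open>k - 1\<close> is harmless, as its term carries the factor \<open>k\<close>.
\<close>

lemma deriv_power_mult:
  assumes "\<psi> holomorphic_on ball 0 1" "h holomorphic_on ball 0 1" "cmod z < 1"
  shows "deriv (\<lambda>z. \<psi> z ^ k * h z) z = of_nat k * \<psi> z ^ (k - 1) * deriv \<psi> z * h z + \<psi> z ^ k * deriv h z"
proof (rule DERIV_imp_deriv)
  have "(\<psi> has_field_derivative deriv \<psi> z) (at z)" "(h has_field_derivative deriv h z) (at z)"
    using assms by (auto intro!: holomorphic_derivI[of _ "ball 0 1"])
  then show "((\<lambda>z. \<psi> z ^ k * h z) has_field_derivative
      of_nat k * \<psi> z ^ (k - 1) * deriv \<psi> z * h z + \<psi> z ^ k * deriv h z) (at z)"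
    by (auto intro!: derivative_eq_intros simp: algebra_simps)
qed

text \<open>
  The factor \<open>k\<close> in \<open>(\<psi>\<^sup>k h)' = k \<psi>\<^sup>k\<^sup>-\<^sup>1 \<psi>' h + \<psi>\<^sup>k h'\<close> is the only source of growth, since
  \<open>\<psi>\<close> is bounded by \<open>1\<close> and \<open>h\<close> is bounded by the sum \<open>H\<close> of the moduli of its coefficients.
\<close>

lemma norm_power_mult_growth:
  assumes psi: "\<psi> \<in> S12" "\<And>z. cmod z < 1 \<Longrightarrow> cmod (\<psi> z) \<le> 1"
    and bdd: "bounded_operator_S12 (mult_operator \<psi>)" and h: "h \<in> S12"
  obtains C where "\<And>k. (S12_norm (\<lambda>z. \<psi> z ^ k * h z))\<^sup>2 \<le> C * (real k + 1) ^ 2"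
proof -
  define H where "H = (\<Sum>n. cmod (taylor_coeff h n))"
  define A where "A = hardy_norm_sq (deriv \<psi>)"
  define B where "B = hardy_norm_sq (deriv h)"
  have nonneg: "0 \<le> A" "0 \<le> B" "0 \<le> hardy_norm_sq h"
    unfolding A_def B_def by (intro hardy_norm_sq_nonneg deriv_in_hardy S12_subset_hardy psi h)+
  have "(S12_norm (\<lambda>z. \<psi> z ^ k * h z))\<^sup>2 \<le> (hardy_norm_sq h + 4 * H\<^sup>2 * A + 4 * B) * (real k + 1) ^ 2" for k
  proof -
    let ?f = "\<lambda>z. \<psi> z ^ k * h z"
    have f: "?f \<in> S12"
      by (rule power_mult_in_S12[OF bdd h])
    have pow_le: "cmod (\<psi> z) ^ l \<le> 1" if "cmod z < 1" for z l
      using psi(2)[OF that] by (simp add: power_le_one)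
    have "hardy_norm_sq ?f \<le> 1 * hardy_norm_sq h + 0 * hardy_norm_sq h"
    proof (intro hardy_norm_sq_le_of_boundary S12_subset_hardy f h)
      fix c :: real
      assume c: "0 < c" "c < 1"
      show "\<forall>\<^sub>F z in disc_boundary. c * (cmod (?f z))\<^sup>2 \<le> 1 * (cmod (h z))\<^sup>2 + 0 * (cmod (h z))\<^sup>2"
        using eventually_in_disc
      proof eventually_elim
        case (elim z)
        have "c * (cmod (?f z))\<^sup>2 \<le> (cmod (?f z))\<^sup>2"
          using c by (intro mult_left_le_one_le) auto
        also have "\<dots> \<le> (cmod (h z))\<^sup>2"
          using pow_le[OF elim, of k] by (intro power_mono) (auto simp: norm_mult norm_power mult_left_le_one_le)
        finally show ?case by simp
      qed
    qed auto
    moreover have "hardy_norm_sq (deriv ?f) \<le> 2 * (real k)\<^sup>2 * H\<^sup>2 * A + 2 * B"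
      unfolding A_def B_def
    proof (intro hardy_norm_sq_le_of_boundary deriv_in_hardy f h psi(1))
      fix c :: real
      assume c: "0 < c" "c < 1"
      show "\<forall>\<^sub>F z in disc_boundary. c * (cmod (deriv ?f z))\<^sup>2 \<le>
          2 * (real k)\<^sup>2 * H\<^sup>2 * (cmod (deriv \<psi> z))\<^sup>2 + 2 * (cmod (deriv h z))\<^sup>2"
        using eventually_in_disc
      proof eventually_elim
        case (elim z)
        define x where "x = real k * H * cmod (deriv \<psi> z)"
        define y where "y = cmod (deriv h z)"
        have "cmod (deriv ?f z) \<le> 
            cmod (of_nat k * \<psi> z ^ (k - 1) * deriv \<psi> z * h z) + cmod (\<psi> z ^ k * deriv h z)"
          using deriv_power_mult[of \<psi> h z k] psi h elim
          by (simp add: S12_holomorphic norm_triangle_ineq)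
        also have "cmod (of_nat k * \<psi> z ^ (k - 1) * deriv \<psi> z * h z) \<le> real k * 1 * cmod (deriv \<psi> z) * H"
          unfolding norm_mult norm_power norm_of_nat H_def
          using pow_le[OF elim] S12_bounded[OF h elim] by (intro mult_mono mult_nonneg_nonneg) auto
        also have "cmod (\<psi> z ^ k * deriv h z) \<le> 1 * cmod (deriv h z)"
          unfolding norm_mult norm_power using pow_le[OF elim] by (intro mult_right_mono) auto
        finally have "cmod (deriv ?f z) \<le> x + y"
          by (simp add: x_def y_def mult_ac)
        then have "(cmod (deriv ?f z))\<^sup>2 \<le> (x + y)\<^sup>2"
          by (intro power_mono) auto
        also have "\<dots> \<le> 2 * x\<^sup>2 + 2 * y\<^sup>2"
          using sum_squares_bound[of x y] by (simp add: power2_sum)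
        finally have "(cmod (deriv ?f z))\<^sup>2 \<le> 2 * x\<^sup>2 + 2 * y\<^sup>2" .
        moreover have "c * (cmod (deriv ?f z))\<^sup>2 \<le> (cmod (deriv ?f z))\<^sup>2"
          using c by (intro mult_left_le_one_le) auto
        ultimately show ?case
          by (simp add: x_def y_def power_mult_distrib)
      qed
    qed auto
    ultimately have "(S12_norm ?f)\<^sup>2 \<le> hardy_norm_sq h + 4 * H\<^sup>2 * A * (real k)\<^sup>2 + 4 * B"
      using S12_norm_power2_le[OF f] by (simp add: algebra_simps)
    also have "\<dots> \<le> hardy_norm_sq h * (real k + 1)\<^sup>2 + 4 * H\<^sup>2 * A * (real k + 1)\<^sup>2 + 4 * B * (real k + 1)\<^sup>2"
    proof -
      have "(1::real) \<le> (real k + 1)\<^sup>2" "(real k)\<^sup>2 \<le> (real k + 1)\<^sup>2"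
        by (auto simp: power2_eq_square algebra_simps)
      then have "hardy_norm_sq h * 1 \<le> hardy_norm_sq h * (real k + 1)\<^sup>2"
        "4 * H\<^sup>2 * A * (real k)\<^sup>2 \<le> 4 * H\<^sup>2 * A * (real k + 1)\<^sup>2"
        "4 * B * 1 \<le> 4 * B * (real k + 1)\<^sup>2"
        using nonneg by (intro mult_left_mono; (assumption | simp))+
      then show ?thesis by linarith
    qed
    finally show ?thesis by (simp add: algebra_simps)
  qed
  then show ?thesis by (rule that)
qed

text \<open>
  In \<open>(\<psi>\<^sup>k)' = k \<psi>\<^sup>k\<^sup>-\<^sup>1 \<psi>'\<close> the factor \<open>\<psi>\<^sup>k\<^sup>-\<^sup>1\<close> has modulus tending to \<open>1\<close> at the circle, so it does
  not lower the Hardy norm.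
\<close>

lemma hardy_norm_sq_deriv_power_ge:
  assumes psi: "\<psi> \<in> S12" "((\<lambda>z. cmod (\<psi> z)) \<longlongrightarrow> 1) disc_boundary"
    and pow: "(\<lambda>z. \<psi> z ^ k) \<in> S12" and "k > 0"
  shows "(real k)\<^sup>2 * hardy_norm_sq (deriv \<psi>) \<le> hardy_norm_sq (deriv (\<lambda>z. \<psi> z ^ k))"
proof -
  let ?f = "\<lambda>z. \<psi> z ^ k"
  have "hardy_norm_sq (deriv \<psi>) \<le> 1 / (real k)\<^sup>2 * hardy_norm_sq (deriv ?f) + 0 * hardy_norm_sq (deriv ?f)"
  proof (intro hardy_norm_sq_le_of_boundary deriv_in_hardy psi pow)
    fix c :: real
    assume c: "0 < c" "c < 1"
    have "((\<lambda>z. (cmod (\<psi> z) ^ (k - 1))\<^sup>2) \<longlongrightarrow> (1 ^ (k - 1))\<^sup>2) disc_boundary"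
      by (intro tendsto_intros psi)
    then have "\<forall>\<^sub>F z in disc_boundary. c < (cmod (\<psi> z) ^ (k - 1))\<^sup>2"
      using c by (intro order_tendstoD(1)) auto
    then show "\<forall>\<^sub>F z in disc_boundary. c * (cmod (deriv \<psi> z))\<^sup>2 \<le>
        1 / (real k)\<^sup>2 * (cmod (deriv ?f z))\<^sup>2 + 0 * (cmod (deriv ?f z))\<^sup>2"
      using eventually_in_disc
    proof eventually_elim
      case (elim z)
      have "deriv ?f z = of_nat k * \<psi> z ^ (k - 1) * deriv \<psi> z"
        using deriv_power_mult[of \<psi> "\<lambda>_. 1" z k] psi elim by (simp add: S12_holomorphic)
      then have "1 / (real k)\<^sup>2 * (cmod (deriv ?f z))\<^sup>2 = (cmod (\<psi> z) ^ (k - 1))\<^sup>2 * (cmod (deriv \<psi> z))\<^sup>2"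
        using \<open>k > 0\<close> by (simp add: norm_mult norm_power power_mult_distrib)
      moreover have "c * (cmod (deriv \<psi> z))\<^sup>2 \<le> (cmod (\<psi> z) ^ (k - 1))\<^sup>2 * (cmod (deriv \<psi> z))\<^sup>2"
        using elim by (intro mult_right_mono) auto
      ultimately show ?case by simp
    qed
  qed auto
  then show ?thesis
    using \<open>k > 0\<close> by (simp add: field_simps)
qed

lemma hardy_norm_sq_deriv_pos:
  assumes "\<psi> \<in> S12" "\<not> \<psi> constant_on ball 0 1"
  shows "hardy_norm_sq (deriv \<psi>) > 0"
proof -
  have "\<exists>n. taylor_coeff \<psi> (Suc n) \<noteq> 0"
  proof (rule ccontr)
    assume "\<not> ?thesis"
    then have 0: "taylor_coeff \<psi> n = 0" if "n \<noteq> 0" for n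
      using that by (cases n) auto
    have "\<psi> z = taylor_coeff \<psi> 0" if "z \<in> ball 0 1" for z
    proof -
      have "(\<lambda>n. taylor_coeff \<psi> n * z ^ n) sums \<psi> z"
        using assms that by (intro taylor_coeff_sums S12_holomorphic) auto
      moreover have "(\<lambda>n. taylor_coeff \<psi> n * z ^ n) sums (\<Sum>n\<in>{0}. taylor_coeff \<psi> n * z ^ n)"
        by (rule sums_finite) (auto simp: 0)
      ultimately show ?thesis
        using sums_unique2 by fastforce
    qed
    then show False
      using assms(2) unfolding constant_on_def by blast
  qed
  then obtain n where "taylor_coeff (deriv \<psi>) n \<noteq> 0"
    by (auto simp: taylor_coeff_deriv simp del: of_nat_Suc)
  then show ?thesis
    unfolding hardy_norm_sq_def using summable_hardy_deriv[OF assms(1)]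
    by (intro suminf_pos2[of _ n]) auto
qed

text \<open>
  A \<open>2\<close>-isometry would make \<open>\<parallel>\<psi>\<^sup>k\<parallel>\<^sup>2\<close> affine in \<open>k\<close>, but it grows at least like a positive multiple
  of \<open>k\<^sup>2\<close>.
\<close>

lemma not_2_isometry:
  assumes psi: "\<psi> \<in> S12" "((\<lambda>z. cmod (\<psi> z)) \<longlongrightarrow> 1) disc_boundary"
    and nonconst: "\<not> \<psi> constant_on ball 0 1"
  shows "\<not> m_isometry 2 (mult_operator \<psi>)"
proof
  assume iso: "m_isometry 2 (mult_operator \<psi>)"
  define A where "A = hardy_norm_sq (deriv \<psi>)"
  define p where "p = (\<lambda>k. (S12_norm (\<lambda>z. \<psi> z ^ k))\<^sup>2)"
  have "A > 0"
    unfolding A_def by (rule hardy_norm_sq_deriv_pos[OF psi(1) nonconst])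
  have one: "(\<lambda>z. 1) \<in> S12"
    using monomial_in_S12[of 0] by simp
  have pow: "(\<lambda>z. \<psi> z ^ k) \<in> S12" for k
    using power_mult_in_S12[OF _ one, of \<psi> k] iso by (simp add: m_isometry_def)
  have "(fdiff ^^ 2) p j = 0" for j
    using iso one unfolding m_isometry_iff_fdiff p_def by fastforce
  then have affine: "p k = p 0 + fdiff p 0 * real k" for k
    using newton_expansion[of 2 p k] by (simp add: numeral_2_eq_2)
  have upper: "(real k)\<^sup>2 * A \<le> 2 * (p 0 + fdiff p 0 * real k)" if "k > 0" for k
    using hardy_norm_sq_deriv_power_ge[OF psi pow that] hardy_norm_sq_deriv_le[OF pow[of k]] affine[of k]
    by (simp add: A_def p_def)
  obtain k where k: "real k > max 1 (2 * (\<bar>p 0\<bar> + \<bar>fdiff p 0\<bar>) / A)"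
    using reals_Archimedean2 by blast
  then have "1 < real k" "2 * (\<bar>p 0\<bar> + \<bar>fdiff p 0\<bar>) < real k * A"
    using \<open>A > 0\<close> by (auto simp: field_simps)
  then have "2 * (\<bar>p 0\<bar> + \<bar>fdiff p 0\<bar>) * real k < real k * A * real k"
    by (intro mult_strict_right_mono) auto
  moreover have "p 0 + fdiff p 0 * real k \<le> \<bar>p 0\<bar> * real k + \<bar>fdiff p 0\<bar> * real k"
  proof (rule add_mono)
    have "\<bar>p 0\<bar> * 1 \<le> \<bar>p 0\<bar> * real k"
      using \<open>1 < real k\<close> by (intro mult_left_mono) auto
    then show "p 0 \<le> \<bar>p 0\<bar> * real k" by linarith
  qed (simp add: mult_right_mono)
  ultimately show False
    using upper[of k] \<open>1 < real k\<close> by (simp add: power2_eq_square algebra_simps)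
qed

section \<open>Rigidity and the exact order\<close>

theorem theorem3p5:
  fixes \<psi> :: "complex \<Rightarrow> complex" and m :: nat
  assumes "\<psi> \<in> S12"
    and "\<not> \<psi> constant_on ball 0 1"
    and "m \<ge> 1"
    and "m_isometry m (mult_operator \<psi>)"
  shows "finite_blaschke_product \<psi> \<and> strict_m_isometry 3 (mult_operator \<psi>)"
proof -
  have inner: "((\<lambda>z. cmod (\<psi> z)) \<longlongrightarrow> 1) disc_boundary"
    using cmod_tendsto_1_of_boundary_ext[OF assms(1) boundary_ext_unimodular[OF assms(1,4)]] .
  have bdd: "bounded_operator_S12 (mult_operator \<psi>)"
    using assms(4) by (simp add: m_isometry_def)
  have "(fdiff ^^ 3) (\<lambda>k. (S12_norm (\<lambda>z. \<psi> z ^ k * h z))\<^sup>2) j = 0" if h: "h \<in> S12" for h j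
  proof -
    let ?p = "\<lambda>k. (S12_norm (\<lambda>z. \<psi> z ^ k * h z))\<^sup>2"
    obtain C where "\<And>k. ?p k \<le> C * (real k + 1) ^ 2"
      using norm_power_mult_growth[OF assms(1) _ bdd h]
        cmod_le_1_of_boundary[OF S12_holomorphic[OF assms(1)] inner] by blast
    moreover have "(fdiff ^^ m) ?p j = 0" for j
      using assms(4) h unfolding m_isometry_iff_fdiff by blast
    ultimately have "(fdiff ^^ Suc 2) ?p j = 0"
      by (intro fdiff_eq_0_of_growth[of m _ C]) auto
    then show ?thesis by (simp add: numeral_3_eq_3 numeral_2_eq_2)
  qed
  then have "m_isometry 3 (mult_operator \<psi>)"
    unfolding m_isometry_iff_fdiff using bdd by blast
  then show ?thesis
    using finite_blaschke_product_of_boundary[OF S12_holomorphic[OF assms(1)] inner]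
      not_2_isometry[OF assms(1) inner assms(2)]
    by (simp add: strict_m_isometry_def)
qed

end
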